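(* Let $M\in\mathbb N$ and $\mathcal A\subset\{0,\dots,M-1\}$ with $1<|\mathcal A|<M$, and put $\delta=\log|\mathcal A|/\log M\in(0,1)$. For $k\in\mathbb N$ and $N=M^k$ let $$\mathcal C_k=\Big\{\sum_{j=0}^{k-1}a_jM^j\ \Big|\ a_0,\dots,a_{k-1}\in\mathcal A\Big\}\subset\mathbb Z_N,\qquad r_k=\|\mathbf 1_{\mathcal C_k}\mathcal F_N\mathbf 1_{\mathcal C_k}\|_{\ell^2_N\to\ell^2_N}.$$ Then the limit $$\beta=\beta(M,\mathcal A)=-\lim_{k\to\infty}\frac{\log r_k}{k\log M}$$ exists and satisfies $\beta>\max(0,\frac12-\delta)$. Moreover, for this $\beta$ and every cutoff $\chi\in C_0^\infty((0,1);[0,1])$, the open quantum baker's maps $B_N=B_{N,\chi}$, $N=M^k$, satisfy $$\limsup_{N\to\infty}\max\{|\lambda|\colon\lambda\in\mathrm{Sp}(B_N)\}\le M^{-\beta},$$ the limit being taken along $N=M^k$, $k\to\infty$.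
   Context: $\mathbb Z_N=\mathbb Z/N\mathbb Z\simeq\{0,\dots,N-1\}$; $\ell^2_N$ is the space of functions $u:\mathbb Z_N\to\mathbb C$ with $\|u\|_{\ell^2_N}^2=\sum_{j=0}^{N-1}|u(j)|^2$. The unitary Fourier transform is $\mathcal F_Nu(j)=\frac1{\sqrt N}\sum_{\ell=0}^{N-1}\exp(-2\pi ij\ell/N)u(\ell)$. For $X\subset\mathbb Z_N$, $\mathbf 1_X$ is the operator of multiplication by the indicator function of $X$. For $\chi\in C_0^\infty((0,1);[0,1])$ (extended by zero), $\chi_N$ is the multiplication operator on $\ell^2_N$ by $\chi_N(j)=\chi(j/N)$, $j\in\{0,\dots,N-1\}$. Open quantum baker's map: for $N=M^k$, $k\in\mathbb N$, and $a\in\{0,\dots,M-1\}$, let $\Pi_a:\ell^2_N\to\ell^2_{N/M}$, $\Pi_au(j)=u(j+aN/M)$ for $j\in\{0,\dots,N/M-1\}$. Then $$B_N=B_{N,\chi}=\sum_{a\in\mathcal A}\mathcal F_N^*\,\Pi_a^*\,\chi_{N/M}\,\mathcal F_{N/M}\,\chi_{N/M}\,\Pi_a:\ell^2_N\to\ell^2_N.$$ $\mathrm{Sp}$ denotes the spectrum. *)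

theory Defs
  imports "HOL-Analysis.Analysis" "Jordan_Normal_Form.Spectral_Radius"
begin

unbundle no vec_syntax
no_notation inner (infix "\<bullet>" 70)
hide_const (open) Finite_Cartesian_Product.mat Finite_Cartesian_Product.vec

text \<open>
  Functions on Z/NZ = {0, ..., N - 1} are vectors in \<open>carrier_vec N\<close>, and linear operators
  from l^2_N to l^2_N' are the matrices in \<open>carrier_mat N' N\<close>.
\<close>

definition l2_norm :: "complex vec \<Rightarrow> real" where
  "l2_norm u = sqrt (\<Sum>j<dim_vec u. (cmod (u $ j))\<^sup>2)"

definition op_norm :: "complex mat \<Rightarrow> real" where
  "op_norm T = (SUP u \<in> {u \<in> carrier_vec (dim_col T). l2_norm u \<le> 1}. l2_norm (T *\<^sub>v u))"

text \<open>The supremum is over a bounded nonempty set of reals.\<close>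

lemma op_norm_nonempty: "{u \<in> carrier_vec (dim_col T). l2_norm u \<le> 1} \<noteq> {}"
proof -
  have "0\<^sub>v (dim_col T) \<in> {u \<in> carrier_vec (dim_col T). l2_norm u \<le> 1}"
    by (simp add: l2_norm_def)
  then show ?thesis by blast
qed

lemma op_norm_bdd_above:
  "bdd_above ((\<lambda>u. l2_norm (T *\<^sub>v u)) ` {u \<in> carrier_vec (dim_col T). l2_norm u \<le> 1})"
proof (rule bdd_aboveI2)
  fix u :: "complex vec"
  assume "u \<in> {u \<in> carrier_vec (dim_col T). l2_norm u \<le> 1}"
  then have dim: "dim_vec u = dim_col T" and le: "l2_norm u \<le> 1" by auto
  have u1: "cmod (u $ j) \<le> 1" if j: "j < dim_col T" for j
  proof -
    have "(cmod (u $ j))\<^sup>2 \<le> (\<Sum>j<dim_vec u. (cmod (u $ j))\<^sup>2)"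
      using j dim by (intro member_le_sum) auto
    also have "\<dots> \<le> 1" using le by (simp add: l2_norm_def)
    finally show ?thesis by (simp add: abs_square_le_1)
  qed
  have row: "cmod ((T *\<^sub>v u) $ i) \<le> (\<Sum>j<dim_col T. cmod (T $$ (i, j)))" if i: "i < dim_row T" for i
  proof -
    have "(T *\<^sub>v u) $ i = (\<Sum>j<dim_col T. T $$ (i, j) * u $ j)"
      using i dim by (auto simp: scalar_prod_def atLeast0LessThan intro!: sum.cong)
    also have "cmod \<dots> \<le> (\<Sum>j<dim_col T. cmod (T $$ (i, j) * u $ j))" by (rule norm_sum)
    also have "\<dots> \<le> (\<Sum>j<dim_col T. cmod (T $$ (i, j)))"
      using u1 by (intro sum_mono) (simp add: norm_mult mult_left_le)
    finally show ?thesis .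
  qed
  show "l2_norm (T *\<^sub>v u) \<le> sqrt (\<Sum>i<dim_row T. (\<Sum>j<dim_col T. cmod (T $$ (i, j)))\<^sup>2)"
    unfolding l2_norm_def using row by (auto intro!: sum_mono power_mono)
qed

definition fourier_mat :: "nat \<Rightarrow> complex mat" where
  "fourier_mat N = mat N N (\<lambda>(j, l).
     exp (- 2 * of_real pi * \<i> * of_nat j * of_nat l / of_nat N) / of_real (sqrt (real N)))"

definition indicator_mat :: "nat \<Rightarrow> nat set \<Rightarrow> complex mat" where
  "indicator_mat N X = mat_diag N (indicator X)"

definition cantor_set :: "nat \<Rightarrow> nat set \<Rightarrow> nat \<Rightarrow> nat set" where
  "cantor_set M A k = {\<Sum>j<k. a j * M ^ j | a :: nat \<Rightarrow> nat. \<forall>j<k. a j \<in> A}"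

definition cantor_norm :: "nat \<Rightarrow> nat set \<Rightarrow> nat \<Rightarrow> real" where
  "cantor_norm M A k =
     op_norm (indicator_mat (M ^ k) (cantor_set M A k) * fourier_mat (M ^ k) *
              indicator_mat (M ^ k) (cantor_set M A k))"

definition cantor_dim :: "nat \<Rightarrow> nat set \<Rightarrow> real" where
  "cantor_dim M A = ln (real (card A)) / ln (real M)"

lemma cantor_dim_bounds:
  assumes "1 < card A" "card A < M"
  shows "0 < cantor_dim M A" "cantor_dim M A < 1"
  using assms by (auto simp: cantor_dim_def)

text \<open>
  Smooth functions on the real line with values in [0, 1] and compact support in (0, 1);
  a closed subset of (0, 1) is automatically compact.
\<close>

definition cutoff :: "(real \<Rightarrow> real) \<Rightarrow> bool" where
  "cutoff \<chi> \<longleftrightarrow>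
     (\<forall>n. (deriv ^^ n) \<chi> differentiable_on UNIV) \<and>
     closure {x. \<chi> x \<noteq> 0} \<subseteq> {0<..<1} \<and>
     range \<chi> \<subseteq> {0..1}"

definition cutoff_mat :: "(real \<Rightarrow> real) \<Rightarrow> nat \<Rightarrow> complex mat" where
  "cutoff_mat \<chi> N = mat_diag N (\<lambda>j. of_real (\<chi> (real j / real N)))"

text \<open>
  \<open>proj_mat M N a\<close> is the operator \<open>\<Pi>\<^sub>a\<close> from l^2_N to l^2_{N/M}; the next lemma gives its
  action on functions.  It is used for N divisible by M.
\<close>

definition proj_mat :: "nat \<Rightarrow> nat \<Rightarrow> nat \<Rightarrow> complex mat" where
  "proj_mat M N a = mat (N div M) N (\<lambda>(j, l). if l = j + a * (N div M) then 1 else 0)"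

lemma proj_mat_apply:
  assumes "u \<in> carrier_vec N" "M dvd N" "a < M" "j < N div M"
  shows "(proj_mat M N a *\<^sub>v u) $ j = u $ (j + a * (N div M))"
proof -
  have "j + a * (N div M) < Suc a * (N div M)" using assms(4) by simp
  also have "\<dots> \<le> M * (N div M)" using assms(3) by (intro mult_le_mono1) simp
  also have "\<dots> = N" using assms(2) by simp
  finally have lt: "j + a * (N div M) < N" .
  have "(proj_mat M N a *\<^sub>v u) $ j
      = (\<Sum>l = 0..<N. (if l = j + a * (N div M) then 1 else 0) * u $ l)"
    using assms(1,4) by (auto simp: proj_mat_def scalar_prod_def intro!: sum.cong)
  also have "\<dots> = (\<Sum>l = 0..<N. if l = j + a * (N div M) then u $ l else 0)"
    by (intro sum.cong) auto
  also have "\<dots> = u $ (j + a * (N div M))" using lt by simp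
  finally show ?thesis .
qed

text \<open>
  The open quantum baker's map \<open>B_{N,\<chi>}\<close>, for N divisible by M.
  The sum is that of the module of N x N complex matrices.
\<close>

definition baker_map :: "nat \<Rightarrow> nat set \<Rightarrow> (real \<Rightarrow> real) \<Rightarrow> nat \<Rightarrow> complex mat" where
  "baker_map M A \<chi> N = finsum (module_mat TYPE(complex) N N)
     (\<lambda>a. mat_adjoint (fourier_mat N) * mat_adjoint (proj_mat M N a) *
          cutoff_mat \<chi> (N div M) * fourier_mat (N div M) * cutoff_mat \<chi> (N div M) *
          proj_mat M N a) A"

lemma finsum_module_mat:
  assumes "finite A" and "\<And>a. a \<in> A \<Longrightarrow> f a \<in> carrier_mat n m"
  shows "finsum (module_mat TYPE(complex) n m) f A = mat n m (\<lambda>ij. \<Sum>a\<in>A. f a $$ ij)"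
proof -
  interpret abelian_group "module_mat TYPE(complex) n m" by (rule abelian_group_mat)
  show ?thesis
    using assms
  proof (induction A rule: finite_induct)
    case empty
    show ?case by (auto simp: module_mat_simps)
  next
    case (insert a A)
    have "finsum (module_mat TYPE(complex) n m) f (insert a A)
        = f a + finsum (module_mat TYPE(complex) n m) f A"
      using insert by (subst finsum_insert) (auto simp: module_mat_simps)
    with insert show ?case by auto
  qed
qed

lemma baker_map_entries:
  assumes "finite A"
  shows "baker_map M A \<chi> N = mat N N (\<lambda>ij. \<Sum>a\<in>A.
     (mat_adjoint (fourier_mat N) * mat_adjoint (proj_mat M N a) *
      cutoff_mat \<chi> (N div M) * fourier_mat (N div M) * cutoff_mat \<chi> (N div M) *
      proj_mat M N a) $$ ij)"
  unfolding baker_map_def using assms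
  by (intro finsum_module_mat)
    (auto simp: fourier_mat_def proj_mat_def cutoff_mat_def mat_adjoint_def mat_diag_def)

end

theory Submission
  imports Defs
begin

text \<open>
Write \<open>C\<^sub>k\<close> for the Cantor set, \<open>F\<close> for the Fourier transform on \<open>N = M^k\<close> points and \<open>r\<^sub>k\<close> for the
norm of \<open>F\<close> between functions on \<open>C\<^sub>k\<close>.  Operators are handled as kernels on finite index sets,
and every estimate is an instance of one predicate, \<open>kernel_bound J L K r\<close>: the operator from
\<open>l\<^sup>2(L)\<close> to \<open>l\<^sup>2(J)\<close> with kernel \<open>K\<close> has norm at most \<open>r\<close>.

The exponent.  Splitting outputs as \<open>j\<^sub>1 + P j\<^sub>2\<close> and inputs as \<open>Q l\<^sub>1 + l\<^sub>2\<close> factors the Fourier kernel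
of size \<open>P Q\<close> into those of sizes \<open>P\<close> and \<open>Q\<close>, up to a phase in \<open>j\<^sub>1\<close> and \<open>l\<^sub>2\<close> alone.  Since a Cantor
set is a product in both splittings, \<open>r\<close> is submultiplicative (\<open>cantor_norm_submult\<close>), and Fekete's
lemma yields the limit \<open>\<beta>\<close> together with \<open>\<beta> \<ge> - ln r\<^sub>k / (k ln M)\<close> for every single \<open>k > 0\<close>.  Hence
each of the two strict lower bounds on \<open>\<beta>\<close> follows from one good value of \<open>k\<close>.
If \<open>r\<^sub>k = 1\<close>, some nonzero function and its Fourier transform both live on \<open>C\<^sub>k\<close>.  As \<open>C\<^sub>k\<close> avoids an
interval of length \<open>M^(k-1)\<close>, the transform is, up to a phase, a polynomial of degree below
\<open>M^k - M^(k-1)\<close>, while it has at least \<open>M^k - |A|^k\<close> zeros among the roots of unity; for large \<open>k\<close>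
these are too many (\<open>cantor_norm_less_1\<close>).  For the other bound, \<open>r\<^sub>2\<close> is at most the Hilbert-Schmidt
norm \<open>|A|^2 / M\<close>, and equality would force the matrix to have rank one, which a nonzero minor
excludes (\<open>cantor_norm_2_less\<close>).

The spectral radius.  The open baker's map is \<open>B = F* D\<close> with \<open>D\<close> a symmetric block-diagonal
contraction.  Repeated summation by parts shows that its entry at \<open>(j, l)\<close> is negligible unless the
leading digit of \<open>l\<close> is in \<open>A\<close> and \<open>j\<close> is close to \<open>M (l mod M^(k-1))\<close> (\<open>baker_kernel_decay\<close>).
Following this relation backwards \<open>k - t\<close> times, \<open>B^(k-t)\<close> depends, up to a negligible error, only on
the values of a function in a set \<open>X\<close> of points within \<open>3 M^t\<close> of \<open>C\<^sub>k\<close>.  Let \<open>B u = \<lambda> u\<close> and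
\<open>v = F u\<close>.  Because \<open>D\<close> and \<open>F\<close> are symmetric, \<open>F B F*\<close> is the transpose of \<open>B\<close>; so \<open>v\<close> is an
eigenvector of the transpose, and the same estimate, transposed, shows that \<open>v\<close> is concentrated
on \<open>X\<close>.  Consequently \<open>|\<lambda>|^(k-t)\<close> is at most the norm of \<open>F*\<close> from \<open>X\<close> to \<open>X\<close> plus a small error
(\<open>eigenvalue_power_le\<close>).  The set \<open>X\<close> is covered by \<open>6 M^t + 1\<close> translates of \<open>C\<^sub>k\<close>, and translating
only multiplies the Fourier kernel by phases, so this norm is at most \<open>(6 M^t + 1)^2 r\<^sub>k\<close>.  Taking
\<open>t\<close> to be a small fraction of \<open>k\<close> gives the claim.
\<close>

section \<open>Operator bounds for kernels on finite sets\<close>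

definition kernel_apply :: "('a \<Rightarrow> 'b \<Rightarrow> complex) \<Rightarrow> 'b set \<Rightarrow> ('b \<Rightarrow> complex) \<Rightarrow> 'a \<Rightarrow> complex" where
  "kernel_apply K L u j = (\<Sum>l\<in>L. K j l * u l)"

definition norm_on :: "'a set \<Rightarrow> ('a \<Rightarrow> complex) \<Rightarrow> real" where
  "norm_on J u = L2_set (\<lambda>j. cmod (u j)) J"

definition kernel_bound :: "'a set \<Rightarrow> 'b set \<Rightarrow> ('a \<Rightarrow> 'b \<Rightarrow> complex) \<Rightarrow> real \<Rightarrow> bool" where
  "kernel_bound J L K r \<longleftrightarrow> (\<forall>u. norm_on J (kernel_apply K L u) \<le> r * norm_on L u)"

lemma norm_on_nonneg [simp]: "0 \<le> norm_on J u"
  by (simp add: norm_on_def)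

lemma norm_on_eq_0_iff: "finite J \<Longrightarrow> norm_on J u = 0 \<longleftrightarrow> (\<forall>j\<in>J. u j = 0)"
  by (simp add: norm_on_def L2_set_eq_0_iff)

lemma norm_on_power2: "(norm_on J u)\<^sup>2 = (\<Sum>j\<in>J. (cmod (u j))\<^sup>2)"
  by (simp add: norm_on_def L2_set_def sum_nonneg)

lemma norm_on_cong: "(\<And>j. j \<in> J \<Longrightarrow> cmod (u j) = cmod (v j)) \<Longrightarrow> norm_on J u = norm_on J v"
  unfolding norm_on_def by (rule L2_set_cong) auto

lemma norm_on_le_iff: "0 \<le> c \<Longrightarrow> norm_on J u \<le> c \<longleftrightarrow> (\<Sum>j\<in>J. (cmod (u j))\<^sup>2) \<le> c\<^sup>2"
  by (metis norm_on_power2 norm_on_nonneg abs_le_square_iff abs_of_nonneg)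

lemma norm_on_mono:
  assumes "finite J" "I \<subseteq> J" "\<And>j. j \<in> I \<Longrightarrow> cmod (u j) \<le> cmod (v j)"
  shows "norm_on I u \<le> norm_on J v"
proof -
  have "(\<Sum>j\<in>I. (cmod (u j))\<^sup>2) \<le> (\<Sum>j\<in>I. (cmod (v j))\<^sup>2)"
    using assms(3) by (intro sum_mono power_mono) auto
  also have "\<dots> \<le> (\<Sum>j\<in>J. (cmod (v j))\<^sup>2)" using assms by (intro sum_mono2) auto
  finally show ?thesis by (simp add: norm_on_le_iff norm_on_power2)
qed

lemma norm_on_triangle: "norm_on J (\<lambda>j. u j + v j) \<le> norm_on J u + norm_on J v"
proof -
  have "norm_on J (\<lambda>j. u j + v j) \<le> L2_set (\<lambda>j. cmod (u j) + cmod (v j)) J"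
    unfolding norm_on_def by (intro L2_set_mono) (auto intro: norm_triangle_ineq)
  also have "\<dots> \<le> norm_on J u + norm_on J v" unfolding norm_on_def by (rule L2_set_triangle_ineq)
  finally show ?thesis .
qed

lemma norm_on_scale: "norm_on J (\<lambda>j. c * u j) = cmod c * norm_on J u"
  unfolding norm_on_def by (simp add: norm_mult L2_set_right_distrib)

lemma norm_on_cnj [simp]: "norm_on J (\<lambda>j. cnj (u j)) = norm_on J u"
  by (simp add: norm_on_def)

lemma norm_on_split:
  assumes "finite J"
  shows "norm_on J u \<le> norm_on (J \<inter> X) u + norm_on (J - X) u"
proof -
  have "(\<Sum>j\<in>J. (cmod (u j))\<^sup>2) = (norm_on (J \<inter> X) u)\<^sup>2 + (norm_on (J - X) u)\<^sup>2"
    unfolding norm_on_power2 using assms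
    by (subst sum.Int_Diff[of J _ X]) auto
  also have "\<dots> \<le> (norm_on (J \<inter> X) u + norm_on (J - X) u)\<^sup>2"
    by (simp add: power2_sum)
  finally show ?thesis by (subst norm_on_le_iff) auto
qed

lemma kernel_apply_cong:
  "(\<And>l. l \<in> L \<Longrightarrow> K j l * u l = K' j l * v l) \<Longrightarrow> kernel_apply K L u j = kernel_apply K' L v j"
  unfolding kernel_apply_def by (rule sum.cong) auto

lemma kernel_apply_split:
  assumes "finite L"
  shows "kernel_apply K L u j = kernel_apply K (L \<inter> X) u j + kernel_apply K (L - X) u j"
  unfolding kernel_apply_def by (rule sum.Int_Diff[OF assms])

lemma norm_on_split_apply:
  assumes fin: "finite V" and XV: "X \<subseteq> V"
  shows "norm_on J (kernel_apply K V u) \<le> norm_on J (kernel_apply K X u) + norm_on J (kernel_apply K (V - X) u)"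
proof -
  have "V \<inter> X = X" using XV by auto
  then have "kernel_apply K V u = (\<lambda>j. kernel_apply K X u j + kernel_apply K (V - X) u j)"
    using kernel_apply_split[OF fin, of K u _ X] by auto
  then show ?thesis by (simp add: norm_on_triangle)
qed

lemma kernel_boundD: "kernel_bound J L K r \<Longrightarrow> norm_on J (kernel_apply K L u) \<le> r * norm_on L u"
  by (simp add: kernel_bound_def)

lemma kernel_boundI_unit:
  assumes fin: "finite L" and le: "\<And>u. norm_on L u \<le> 1 \<Longrightarrow> norm_on J (kernel_apply K L u) \<le> r"
  shows "kernel_bound J L K r"
  unfolding kernel_bound_def
proof
  fix u
  show "norm_on J (kernel_apply K L u) \<le> r * norm_on L u"
  proof (cases "norm_on L u = 0")
    case True
    then have "\<forall>l\<in>L. u l = 0" using fin by (simp add: norm_on_eq_0_iff)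
    then have "kernel_apply K L u = (\<lambda>j. 0)" by (auto simp: kernel_apply_def)
    then show ?thesis using True by (simp add: norm_on_def L2_set_def)
  next
    case False
    then have pos: "0 < norm_on L u" using norm_on_nonneg[of L u] by linarith
    define c where "c = complex_of_real (1 / norm_on L u)"
    have c: "cmod c = 1 / norm_on L u" using pos by (simp add: c_def norm_divide)
    have "norm_on J (kernel_apply K L (\<lambda>l. c * u l)) \<le> r"
      using pos by (intro le) (simp add: norm_on_scale c)
    also have "kernel_apply K L (\<lambda>l. c * u l) = (\<lambda>j. c * kernel_apply K L u j)"
      by (auto simp: kernel_apply_def sum_distrib_left mult_ac)
    finally show ?thesis using pos by (simp add: norm_on_scale c field_simps)
  qed
qed

lemma kernel_bound_cong:
  assumes "\<And>j l. j \<in> J \<Longrightarrow> l \<in> L \<Longrightarrow> K j l = K' j l"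
  shows "kernel_bound J L K r \<longleftrightarrow> kernel_bound J L K' r"
proof -
  have "norm_on J (kernel_apply K L u) = norm_on J (kernel_apply K' L u)" for u
    using assms by (intro norm_on_cong arg_cong[where f = cmod] kernel_apply_cong) auto
  then show ?thesis by (simp add: kernel_bound_def)
qed

text \<open>
Shrinking the set of inputs is extension by zero; shrinking the set of outputs drops terms from
the norm.
\<close>

lemma kernel_bound_mono:
  assumes K: "kernel_bound J L K r" and "I \<subseteq> J" "H \<subseteq> L" "finite J" "finite L" "r \<le> s" "0 \<le> s"
  shows "kernel_bound I H K s"
  unfolding kernel_bound_def
proof
  fix u
  define v :: "_ \<Rightarrow> complex" where "v l = (if l \<in> H then u l else 0)" for l
  have "kernel_apply K H u j = kernel_apply K L v j" for j
    unfolding kernel_apply_def v_def using assms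
    by (intro sum.mono_neutral_cong_left) auto
  then have "norm_on I (kernel_apply K H u) \<le> norm_on J (kernel_apply K L v)"
    using assms by (intro norm_on_mono) auto
  also have "\<dots> \<le> r * norm_on L v" by (rule kernel_boundD[OF K])
  also have "\<dots> \<le> s * norm_on L v" using assms by (intro mult_right_mono) auto
  also have "(\<Sum>l\<in>H. (cmod (u l))\<^sup>2) = (\<Sum>l\<in>L. (cmod (v l))\<^sup>2)"
    unfolding v_def using assms by (intro sum.mono_neutral_cong_left) auto
  then have "norm_on L v = norm_on H u" by (simp add: norm_on_def L2_set_def)
  finally show "norm_on I (kernel_apply K H u) \<le> s * norm_on H u" .
qed

lemma kernel_bound_add:
  assumes "kernel_bound J L K r" "kernel_bound J L K' s"
  shows "kernel_bound J L (\<lambda>j l. K j l + K' j l) (r + s)"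
  unfolding kernel_bound_def
proof
  fix u
  have "kernel_apply (\<lambda>j l. K j l + K' j l) L u = (\<lambda>j. kernel_apply K L u j + kernel_apply K' L u j)"
    by (auto simp: kernel_apply_def sum.distrib distrib_right)
  then have "norm_on J (kernel_apply (\<lambda>j l. K j l + K' j l) L u)
      \<le> norm_on J (kernel_apply K L u) + norm_on J (kernel_apply K' L u)"
    by (simp add: norm_on_triangle)
  also have "\<dots> \<le> (r + s) * norm_on L u"
    using assms[THEN kernel_boundD, of u] by (simp add: distrib_right)
  finally show "norm_on J (kernel_apply (\<lambda>j l. K j l + K' j l) L u) \<le> (r + s) * norm_on L u" .
qed

lemma kernel_bound_comp:
  assumes "kernel_bound J P K r" "kernel_bound P L K' s" "0 \<le> r"
  shows "kernel_bound J L (\<lambda>j l. \<Sum>p\<in>P. K j p * K' p l) (r * s)"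
  unfolding kernel_bound_def
proof
  fix u
  have "kernel_apply (\<lambda>j l. \<Sum>p\<in>P. K j p * K' p l) L u = kernel_apply K P (kernel_apply K' L u)"
  proof
    fix j
    have "kernel_apply (\<lambda>j l. \<Sum>p\<in>P. K j p * K' p l) L u j = (\<Sum>l\<in>L. \<Sum>p\<in>P. K j p * K' p l * u l)"
      by (simp add: kernel_apply_def sum_distrib_right)
    also have "\<dots> = (\<Sum>p\<in>P. \<Sum>l\<in>L. K j p * K' p l * u l)" by (rule sum.swap)
    also have "\<dots> = kernel_apply K P (kernel_apply K' L u) j"
      by (simp add: kernel_apply_def sum_distrib_left mult.assoc)
    finally show "kernel_apply (\<lambda>j l. \<Sum>p\<in>P. K j p * K' p l) L u j
      = kernel_apply K P (kernel_apply K' L u) j" .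
  qed
  then have "norm_on J (kernel_apply (\<lambda>j l. \<Sum>p\<in>P. K j p * K' p l) L u)
      \<le> r * norm_on P (kernel_apply K' L u)"
    using kernel_boundD[OF assms(1)] by simp
  also have "\<dots> \<le> r * (s * norm_on L u)"
    using kernel_boundD[OF assms(2)] assms(3) by (intro mult_left_mono) auto
  finally show "norm_on J (kernel_apply (\<lambda>j l. \<Sum>p\<in>P. K j p * K' p l) L u) \<le> r * s * norm_on L u"
    by (simp add: mult.assoc)
qed

lemma Cauchy_Schwarz_nrm: "cmod (\<Sum>j\<in>J. u j * v j) \<le> norm_on J u * norm_on J v"
proof -
  have "cmod (\<Sum>j\<in>J. u j * v j) \<le> (\<Sum>j\<in>J. \<bar>cmod (u j)\<bar> * \<bar>cmod (v j)\<bar>)"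
    by (rule order_trans[OF norm_sum]) (simp add: norm_mult)
  also have "\<dots> \<le> norm_on J u * norm_on J v" unfolding norm_on_def by (rule L2_set_mult_ineq)
  finally show ?thesis .
qed

text \<open>
An operator and its transpose have the same norm: with \<open>x = K\<^sup>T w\<close>, the square of the norm of \<open>x\<close> is
the bilinear pairing of \<open>w\<close> with \<open>K\<close> applied to the conjugate of \<open>x\<close>, and Cauchy-Schwarz leaves one
factor of the norm of \<open>x\<close> on the right.
\<close>

lemma kernel_bound_transpose:
  assumes "kernel_bound J L K r" "0 \<le> r"
  shows "kernel_bound L J (\<lambda>l j. K j l) r"
  unfolding kernel_bound_def
proof
  fix w
  define x where "x = kernel_apply (\<lambda>l j. K j l) J w"
  have "complex_of_real ((norm_on L x)\<^sup>2) = (\<Sum>l\<in>L. x l * cnj (x l))"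
    unfolding norm_on_power2 by (simp add: complex_norm_square[symmetric])
  also have "\<dots> = (\<Sum>l\<in>L. \<Sum>j\<in>J. K j l * w j * cnj (x l))"
    by (subst x_def) (simp add: kernel_apply_def sum_distrib_right)
  also have "\<dots> = (\<Sum>j\<in>J. \<Sum>l\<in>L. K j l * w j * cnj (x l))" by (rule sum.swap)
  also have "\<dots> = (\<Sum>j\<in>J. w j * kernel_apply K L (\<lambda>l. cnj (x l)) j)"
    by (simp add: kernel_apply_def sum_distrib_left mult_ac)
  finally have "(norm_on L x)\<^sup>2 = cmod (\<Sum>j\<in>J. w j * kernel_apply K L (\<lambda>l. cnj (x l)) j)"
    by (metis norm_of_real abs_of_nonneg zero_le_power2)
  also have "\<dots> \<le> norm_on J w * norm_on J (kernel_apply K L (\<lambda>l. cnj (x l)))"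
    by (rule Cauchy_Schwarz_nrm)
  also have "\<dots> \<le> norm_on J w * (r * norm_on L x)"
    using kernel_boundD[OF assms(1), of "\<lambda>l. cnj (x l)"] by (intro mult_left_mono) auto
  finally have le: "norm_on L x * norm_on L x \<le> (r * norm_on J w) * norm_on L x"
    by (simp add: power2_eq_square mult_ac)
  show "norm_on L x \<le> r * norm_on J w"
  proof (cases "norm_on L x = 0")
    case True
    then show ?thesis using assms(2) by simp
  next
    case False
    then have "0 < norm_on L x" using norm_on_nonneg[of L x] by linarith
    then show ?thesis using le by simp
  qed
qed

lemma kernel_bound_cnj:
  assumes "kernel_bound J L K r"
  shows "kernel_bound J L (\<lambda>j l. cnj (K j l)) r"
  unfolding kernel_bound_def
proof
  fix u
  have "kernel_apply (\<lambda>j l. cnj (K j l)) L u = (\<lambda>j. cnj (kernel_apply K L (\<lambda>l. cnj (u l)) j))"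
    by (auto simp: kernel_apply_def)
  then show "norm_on J (kernel_apply (\<lambda>j l. cnj (K j l)) L u) \<le> r * norm_on L u"
    using kernel_boundD[OF assms, of "\<lambda>l. cnj (u l)"] by simp
qed

text \<open>
The operator norm is at most the Hilbert-Schmidt norm, here estimated through the largest entry.
\<close>

lemma kernel_bound_entries:
  assumes "finite J" "finite L" "0 \<le> c" "\<And>j l. j \<in> J \<Longrightarrow> l \<in> L \<Longrightarrow> cmod (K j l) \<le> c"
  shows "kernel_bound J L K (sqrt (card J * card L) * c)"
  unfolding kernel_bound_def
proof
  fix u
  have row: "cmod (kernel_apply K L u j) \<le> sqrt (card L) * c * norm_on L u" if "j \<in> J" for j
  proof -
    have "cmod (kernel_apply K L u j) \<le> norm_on L (K j) * norm_on L u"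
      unfolding kernel_apply_def by (rule Cauchy_Schwarz_nrm)
    also have "norm_on L (K j) \<le> L2_set (\<lambda>l. c) L"
      unfolding norm_on_def using that assms by (intro L2_set_mono) auto
    also have "\<dots> = sqrt (card L) * c" using assms by (simp add: L2_set_constant)
    finally show ?thesis by (simp add: mult_right_mono)
  qed
  have "norm_on J (kernel_apply K L u) \<le> L2_set (\<lambda>j. sqrt (card L) * c * norm_on L u) J"
    unfolding norm_on_def[of J] using row by (intro L2_set_mono) auto
  also have "\<dots> = sqrt (card J * card L) * c * norm_on L u"
    using assms by (simp add: L2_set_constant real_sqrt_mult)
  finally show "norm_on J (kernel_apply K L u) \<le> sqrt (card J * card L) * c * norm_on L u" .
qed

lemma kernel_bound_diag:
  assumes "finite J" "\<And>j. j \<in> J \<Longrightarrow> cmod (d j) \<le> 1"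
  shows "kernel_bound J J (\<lambda>j l. if j = l then d j else 0) 1"
proof -
  have "kernel_apply (\<lambda>j l. if j = l then d j else 0) J u j = d j * u j" if "j \<in> J" for u j
  proof -
    have "kernel_apply (\<lambda>j l. if j = l then d j else 0) J u j = (\<Sum>l\<in>J. if j = l then d j * u l else 0)"
      unfolding kernel_apply_def by (intro sum.cong) auto
    then show ?thesis using assms that by simp
  qed
  then have "norm_on J (kernel_apply (\<lambda>j l. if j = l then d j else 0) J u) \<le> norm_on J u" for u
    using assms by (intro norm_on_mono) (auto simp: norm_mult mult_left_le_one_le)
  then show ?thesis by (simp add: kernel_bound_def)
qed

lemma kernel_bound_weights:
  assumes K: "kernel_bound J L K r" "0 \<le> r" and fin: "finite J" "finite L"
    and c: "\<And>j. j \<in> J \<Longrightarrow> cmod (c j) \<le> 1" and d: "\<And>l. l \<in> L \<Longrightarrow> cmod (d l) \<le> 1"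
  shows "kernel_bound J L (\<lambda>j l. c j * K j l * d l) r"
  unfolding kernel_bound_def
proof
  fix u
  have "kernel_apply (\<lambda>j l. c j * K j l * d l) L u = (\<lambda>j. c j * kernel_apply K L (\<lambda>l. d l * u l) j)"
    by (auto simp: kernel_apply_def sum_distrib_left mult_ac)
  then have "norm_on J (kernel_apply (\<lambda>j l. c j * K j l * d l) L u) \<le> norm_on J (kernel_apply K L (\<lambda>l. d l * u l))"
    using c fin by (auto intro!: norm_on_mono simp: norm_mult mult_left_le_one_le)
  also have "\<dots> \<le> r * norm_on L (\<lambda>l. d l * u l)" by (rule kernel_boundD[OF K(1)])
  also have "\<dots> \<le> r * norm_on L u"
    using d fin K(2) by (intro mult_left_mono norm_on_mono) (auto simp: norm_mult mult_left_le_one_le)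
  finally show "norm_on J (kernel_apply (\<lambda>j l. c j * K j l * d l) L u) \<le> r * norm_on L u" .
qed

lemma kernel_bound_reindex:
  fixes f :: "'a \<Rightarrow> 'b" and g :: "'c \<Rightarrow> 'd"
  assumes "inj_on f J" "inj_on g L"
  shows "kernel_bound (f ` J) (g ` L) K r \<longleftrightarrow> kernel_bound J L (\<lambda>j l. K (f j) (g l)) r"
proof -
  have nf: "norm_on (f ` J) u = norm_on J (\<lambda>j. u (f j))" for u
    unfolding norm_on_def L2_set_def using assms by (simp add: sum.reindex)
  have ng: "norm_on (g ` L) u = norm_on L (\<lambda>l. u (g l))" for u
    unfolding norm_on_def L2_set_def using assms by (simp add: sum.reindex)
  have ap: "kernel_apply K (g ` L) u (f j) = kernel_apply (\<lambda>j l. K (f j) (g l)) L (\<lambda>l. u (g l)) j" for u j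
    unfolding kernel_apply_def using assms by (simp add: sum.reindex)
  show ?thesis
  proof
    assume a: "kernel_bound (f ` J) (g ` L) K r"
    show "kernel_bound J L (\<lambda>j l. K (f j) (g l)) r"
      unfolding kernel_bound_def
    proof
      fix u :: "'c \<Rightarrow> complex"
      define v where "v = (\<lambda>x. u (inv_into L g x))"
      have v: "v (g l) = u l" if "l \<in> L" for l using that assms by (simp add: v_def)
      have "norm_on J (kernel_apply (\<lambda>j l. K (f j) (g l)) L u)
          = norm_on J (kernel_apply (\<lambda>j l. K (f j) (g l)) L (\<lambda>l. v (g l)))"
        by (intro norm_on_cong arg_cong[where f = cmod] kernel_apply_cong) (simp add: v)
      also have "\<dots> \<le> r * norm_on L (\<lambda>l. v (g l))"
        using kernel_boundD[OF a, of v] by (simp add: nf ng ap)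
      also have "norm_on L (\<lambda>l. v (g l)) = norm_on L u" by (rule norm_on_cong) (simp add: v)
      finally show "norm_on J (kernel_apply (\<lambda>j l. K (f j) (g l)) L u) \<le> r * norm_on L u" .
    qed
  qed (auto simp: kernel_bound_def nf ng ap)
qed

lemma kernel_bound_UN_rows:
  assumes "finite I" "\<And>s. s \<in> I \<Longrightarrow> finite (J s)" "\<And>s. s \<in> I \<Longrightarrow> kernel_bound (J s) L K r" "0 \<le> r"
  shows "kernel_bound (\<Union>s\<in>I. J s) L K (real (card I) * r)"
  unfolding kernel_bound_def
proof
  fix u
  have union: "norm_on (\<Union>s\<in>I. J s) v \<le> (\<Sum>s\<in>I. norm_on (J s) v)" for v
    using assms(1,2)
  proof (induction I rule: finite_induct)
    case empty
    show ?case by (simp add: norm_on_def)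
  next
    case (insert s I)
    have "norm_on (\<Union>s\<in>insert s I. J s) v
        \<le> norm_on ((\<Union>s\<in>insert s I. J s) \<inter> J s) v + norm_on ((\<Union>s\<in>insert s I. J s) - J s) v"
      using insert by (intro norm_on_split) auto
    also have "\<dots> \<le> norm_on (J s) v + norm_on (\<Union>s\<in>I. J s) v"
      using insert by (intro add_mono norm_on_mono) auto
    finally show ?case using insert by force
  qed
  have "norm_on (\<Union>s\<in>I. J s) (kernel_apply K L u) \<le> (\<Sum>s\<in>I. norm_on (J s) (kernel_apply K L u))"
    by (rule union)
  also have "\<dots> \<le> (\<Sum>s\<in>I. r * norm_on L u)"
    using assms(3) by (intro sum_mono) (auto dest: kernel_boundD)
  finally show "norm_on (\<Union>s\<in>I. J s) (kernel_apply K L u) \<le> real (card I) * r * norm_on L u" by simp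
qed

text \<open>
A tensor product whose two factors are coupled by a weight \<open>w\<close>.  The coupling is harmless because
\<open>w\<close> depends on the output of the first factor and the input of the second: applying \<open>K1\<close> first, then
multiplying by \<open>w\<close>, then applying \<open>K2\<close>, every step is bounded slice by slice.  With the twiddle
factors as weight this is the step of the fast Fourier transform; with \<open>K2\<close> a projection and \<open>w = 1\<close>
it bounds block-diagonal operators.
\<close>

lemma kernel_bound_tensor:
  assumes fin: "finite J1" "finite L1" "finite J2" "finite L2"
    and K1: "kernel_bound J1 L1 K1 r1" "0 \<le> r1"
    and K2: "kernel_bound J2 L2 K2 r2" "0 \<le> r2"
    and w: "\<And>j1 l2. j1 \<in> J1 \<Longrightarrow> l2 \<in> L2 \<Longrightarrow> cmod (w j1 l2) \<le> 1"
  shows "kernel_bound (J1 \<times> J2) (L1 \<times> L2)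
    (\<lambda>(j1, j2) (l1, l2). K1 j1 l1 * K2 j2 l2 * w j1 l2) (r1 * r2)"
  (is "kernel_bound _ _ ?K _")
  unfolding kernel_bound_def
proof
  fix u :: "'b \<times> 'd \<Rightarrow> complex"
  define x where "x j1 l2 = kernel_apply K1 L1 (\<lambda>l1. u (l1, l2)) j1" for j1 l2
  have eq: "kernel_apply ?K (L1 \<times> L2) u (j1, j2) = kernel_apply K2 L2 (\<lambda>l2. w j1 l2 * x j1 l2) j2" for j1 j2
  proof -
    have "kernel_apply ?K (L1 \<times> L2) u (j1, j2)
        = (\<Sum>l1\<in>L1. \<Sum>l2\<in>L2. K1 j1 l1 * K2 j2 l2 * w j1 l2 * u (l1, l2))"
      unfolding kernel_apply_def by (simp add: sum.cartesian_product split_beta)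
    also have "\<dots> = (\<Sum>l2\<in>L2. \<Sum>l1\<in>L1. K1 j1 l1 * K2 j2 l2 * w j1 l2 * u (l1, l2))"
      by (rule sum.swap)
    also have "\<dots> = kernel_apply K2 L2 (\<lambda>l2. w j1 l2 * x j1 l2) j2"
      unfolding kernel_apply_def x_def by (simp add: sum_distrib_left mult_ac)
    finally show ?thesis .
  qed
  have step1: "(\<Sum>j2\<in>J2. (cmod (kernel_apply K2 L2 (\<lambda>l2. w j1 l2 * x j1 l2) j2))\<^sup>2)
      \<le> r2\<^sup>2 * (\<Sum>l2\<in>L2. (cmod (x j1 l2))\<^sup>2)" if j1: "j1 \<in> J1" for j1
  proof -
    have "norm_on J2 (kernel_apply K2 L2 (\<lambda>l2. w j1 l2 * x j1 l2)) \<le> r2 * norm_on L2 (\<lambda>l2. w j1 l2 * x j1 l2)"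
      by (rule kernel_boundD[OF K2(1)])
    also have "\<dots> \<le> r2 * norm_on L2 (x j1)"
      using fin w[OF j1] K2(2)
      by (intro mult_left_mono norm_on_mono) (auto simp: norm_mult mult_left_le_one_le)
    finally show ?thesis using K2(2) by (simp add: norm_on_le_iff power_mult_distrib norm_on_power2)
  qed
  have step2: "(\<Sum>j1\<in>J1. (cmod (x j1 l2))\<^sup>2) \<le> r1\<^sup>2 * (\<Sum>l1\<in>L1. (cmod (u (l1, l2)))\<^sup>2)" for l2
    using kernel_boundD[OF K1(1), of "\<lambda>l1. u (l1, l2)"] K1(2)
    by (simp add: norm_on_le_iff power_mult_distrib norm_on_power2 x_def)
  have "(\<Sum>p\<in>J1 \<times> J2. (cmod (kernel_apply ?K (L1 \<times> L2) u p))\<^sup>2)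
      = (\<Sum>j1\<in>J1. \<Sum>j2\<in>J2. (cmod (kernel_apply K2 L2 (\<lambda>l2. w j1 l2 * x j1 l2) j2))\<^sup>2)"
    unfolding eq[symmetric] by (simp add: sum.cartesian_product split_beta)
  also have "\<dots> \<le> (\<Sum>j1\<in>J1. r2\<^sup>2 * (\<Sum>l2\<in>L2. (cmod (x j1 l2))\<^sup>2))"
    by (intro sum_mono step1)
  also have "\<dots> = r2\<^sup>2 * (\<Sum>l2\<in>L2. \<Sum>j1\<in>J1. (cmod (x j1 l2))\<^sup>2)"
    by (subst sum.swap) (simp add: sum_distrib_left)
  also have "\<dots> \<le> r2\<^sup>2 * (\<Sum>l2\<in>L2. r1\<^sup>2 * (\<Sum>l1\<in>L1. (cmod (u (l1, l2)))\<^sup>2))"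
    by (intro mult_left_mono sum_mono step2) auto
  also have "\<dots> = (r1 * r2)\<^sup>2 * (\<Sum>l1\<in>L1. \<Sum>l2\<in>L2. (cmod (u (l1, l2)))\<^sup>2)"
    by (subst sum.swap[of _ L2 L1])
      (simp add: sum_distrib_left[symmetric] power_mult_distrib mult_ac)
  also have "\<dots> = (r1 * r2 * norm_on (L1 \<times> L2) u)\<^sup>2"
    by (simp add: power_mult_distrib norm_on_power2 sum.cartesian_product)
  finally show "norm_on (J1 \<times> J2) (kernel_apply ?K (L1 \<times> L2) u) \<le> r1 * r2 * norm_on (L1 \<times> L2) u"
    using K1(2) K2(2) by (simp add: norm_on_le_iff)
qed

text \<open>
Operator norms are attained in finite dimension.  Functions supported on \<open>L\<close> with values in the unit
disc are viewed inside the product of all discs, which is compact by Tychonoff's theorem; this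
serves every index type at once.
\<close>

lemma kernel_maximiser_exists:
  fixes K :: "'a \<Rightarrow> 'b \<Rightarrow> complex"
  assumes "finite L"
  obtains u where "norm_on L u \<le> 1"
    "\<And>w. norm_on L w \<le> 1 \<Longrightarrow> norm_on J (kernel_apply K L w) \<le> norm_on J (kernel_apply K L u)"
proof -
  define S where "S = (PiE UNIV (\<lambda>_. cball 0 1) :: ('b \<Rightarrow> complex) set)"
  have "compactin (product_topology (\<lambda>_. euclidean) UNIV) S"
    unfolding S_def by (subst compactin_PiE) auto
  then have S: "compact S"
    by (simp add: euclidean_product_topology)
  have contL: "continuous_on UNIV (\<lambda>u :: 'b \<Rightarrow> complex. norm_on L u)"
    unfolding norm_on_def L2_set_def by (intro continuous_intros continuous_on_product_coordinates)
  have contJ: "continuous_on UNIV (\<lambda>u. norm_on J (kernel_apply K L u))"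
    unfolding kernel_apply_def norm_on_def L2_set_def by (intro continuous_intros continuous_on_product_coordinates)
  have "closed ((\<lambda>u. norm_on L u) -` {..1})"
    using contL by (intro closed_vimage) auto
  then have cpt: "compact (S \<inter> (\<lambda>u. norm_on L u) -` {..1})" by (rule compact_Int_closed[OF S])
  have ne: "(\<lambda>_. 0) \<in> S \<inter> (\<lambda>u. norm_on L u) -` {..1}"
    by (auto simp: S_def norm_on_def L2_set_def)
  obtain u where u: "u \<in> S \<inter> (\<lambda>u. norm_on L u) -` {..1}"
    and max: "\<And>w. w \<in> S \<inter> (\<lambda>u. norm_on L u) -` {..1} \<Longrightarrow>
      norm_on J (kernel_apply K L w) \<le> norm_on J (kernel_apply K L u)"
    using continuous_attains_sup[OF cpt _ continuous_on_subset[OF contJ subset_UNIV]] ne by blast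
  show thesis
  proof (rule that)
    show "norm_on L u \<le> 1" using u by simp
    fix w :: "'b \<Rightarrow> complex" assume w: "norm_on L w \<le> 1"
    define w' where "w' l = (if l \<in> L then w l else 0)" for l
    have "cmod (w l) \<le> 1" if "l \<in> L" for l
    proof -
      have "(cmod (w l))\<^sup>2 \<le> (norm_on L w)\<^sup>2"
        unfolding norm_on_power2 using assms that by (intro member_le_sum) auto
      then show ?thesis using w by (metis abs_le_square_iff abs_norm_cancel abs_of_nonneg norm_on_nonneg order_trans)
    qed
    then have "w' \<in> S" by (auto simp: S_def w'_def)
    moreover have "norm_on L w' = norm_on L w" by (rule norm_on_cong) (simp add: w'_def)
    ultimately have "norm_on J (kernel_apply K L w') \<le> norm_on J (kernel_apply K L u)"
      using w by (intro max) auto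
    moreover have "kernel_apply K L w' = kernel_apply K L w"
      by (rule ext, rule kernel_apply_cong) (simp add: w'_def)
    ultimately show "norm_on J (kernel_apply K L w) \<le> norm_on J (kernel_apply K L u)" by simp
  qed
qed

section \<open>The unitary discrete Fourier transform\<close>

definition fourier_kernel :: "nat \<Rightarrow> nat \<Rightarrow> nat \<Rightarrow> complex" where
  "fourier_kernel N j l = cis (- 2 * pi * real j * real l / real N) / complex_of_real (sqrt (real N))"

lemma fourier_mat_index:
  assumes "j < N" "l < N"
  shows "fourier_mat N $$ (j, l) = fourier_kernel N j l"
proof -
  have "- 2 * complex_of_real pi * \<i> * of_nat j * of_nat l / of_nat N
      = \<i> * complex_of_real (- 2 * pi * real j * real l / real N)"
    by simp
  then have "exp (- 2 * complex_of_real pi * \<i> * of_nat j * of_nat l / of_nat N)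
      = cis (- 2 * pi * real j * real l / real N)"
    by (simp only: cis_conv_exp)
  then show ?thesis
    using assms unfolding fourier_mat_def fourier_kernel_def index_mat(1)[OF assms] split_conv by simp
qed

lemma fourier_kernel_sym: "fourier_kernel N j l = fourier_kernel N l j"
  by (simp add: fourier_kernel_def mult_ac)

lemma norm_fourier_kernel: "cmod (fourier_kernel N j l) = 1 / sqrt (real N)"
  by (simp add: fourier_kernel_def norm_divide)

lemma cnj_fourier_kernel:
  "cnj (fourier_kernel N j l) = cis (2 * pi * real j * real l / real N) / of_real (sqrt (real N))"
  by (simp add: fourier_kernel_def cis_cnj)

lemma cis_nat_mult_2pi [simp]: "cis (2 * pi * real m) = 1"
  by (metis cis_multiple_2pi Ints_of_nat)

lemma cis_2pi_eq_1_iff: "cis (2 * pi * x) = 1 \<longleftrightarrow> x \<in> \<int>"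
proof
  assume "cis (2 * pi * x) = 1"
  then have "cos (2 * pi * x) = 1" by (metis cis.sel(1) one_complex.sel(1))
  then obtain n :: int where "2 * pi * x = of_int n * 2 * pi" using cos_one_2pi_int by blast
  then have "x = of_int n" by simp
  then show "x \<in> \<int>" by simp
qed (rule cis_multiple_2pi)

text \<open>
A geometric sum over the powers of a nontrivial \<open>N\<close>-th root of unity.
\<close>

lemma sum_cis_orthogonal:
  assumes "l < N" "m < N"
  shows "(\<Sum>j<N. cis (2 * pi * (real l - real m) / real N * real j)) = (if l = m then of_nat N else 0)"
proof (cases "l = m")
  case False
  define z where "z = cis (2 * pi * ((real l - real m) / real N))"
  have "(real l - real m) / real N \<notin> \<int>"
  proof
    assume "(real l - real m) / real N \<in> \<int>"
    moreover have "\<bar>(real l - real m) / real N\<bar> < 1" using assms by (auto simp: abs_less_iff field_simps)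
    ultimately have "(real l - real m) / real N = 0"
      by (metis Ints_nonzero_abs_ge1 not_less)
    then show False using False assms by simp
  qed
  then have "z \<noteq> 1" unfolding z_def cis_2pi_eq_1_iff .
  moreover have "z ^ N = 1"
  proof -
    have "z ^ N = cis (2 * pi * of_int (int l - int m))"
      using assms by (simp add: z_def Complex.DeMoivre)
    then show ?thesis by (metis cis_multiple_2pi Ints_of_int)
  qed
  moreover have "(\<Sum>j<N. cis (2 * pi * (real l - real m) / real N * real j)) = (\<Sum>j<N. z ^ j)"
    unfolding z_def Complex.DeMoivre by (intro sum.cong arg_cong[where f = cis]) (simp_all add: mult_ac)
  ultimately show ?thesis using False by (simp add: geometric_sum)
qed simp

lemma fourier_kernel_orthogonal:
  assumes "l < N" "m < N"
  shows "(\<Sum>j<N. cnj (fourier_kernel N j l) * fourier_kernel N j m) = (if l = m then 1 else 0)"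
proof -
  have "cnj (fourier_kernel N j l) * fourier_kernel N j m
      = cis (2 * pi * (real l - real m) / real N * real j) / of_nat N" for j
  proof -
    have "complex_of_real (sqrt (real N)) * complex_of_real (sqrt (real N)) = of_nat N"
      unfolding of_real_mult[symmetric] by simp
    moreover have "cis (2 * pi * real j * real l / real N) * cis (- 2 * pi * real j * real m / real N)
        = cis (2 * pi * (real l - real m) / real N * real j)"
      unfolding cis_mult by (rule arg_cong[where f = cis]) (simp add: algebra_simps diff_divide_distrib)
    ultimately show ?thesis
      by (simp add: fourier_kernel_def cis_cnj)
  qed
  then have "(\<Sum>j<N. cnj (fourier_kernel N j l) * fourier_kernel N j m)
      = (\<Sum>j<N. cis (2 * pi * (real l - real m) / real N * real j)) / of_nat N"
    by (simp add: sum_divide_distrib)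
  then show ?thesis using sum_cis_orthogonal[OF assms] assms by simp
qed

lemma fourier_inversion:
  assumes "l < N"
  shows "kernel_apply (\<lambda>j l. cnj (fourier_kernel N j l)) {..<N} (kernel_apply (fourier_kernel N) {..<N} u) l = u l"
proof -
  have "kernel_apply (\<lambda>j l. cnj (fourier_kernel N j l)) {..<N} (kernel_apply (fourier_kernel N) {..<N} u) l
      = (\<Sum>j<N. \<Sum>m<N. cnj (fourier_kernel N j l) * fourier_kernel N j m * u m)"
    unfolding kernel_apply_def by (simp add: sum_distrib_left fourier_kernel_sym[of N l] mult.assoc)
  also have "\<dots> = (\<Sum>m<N. (\<Sum>j<N. cnj (fourier_kernel N j l) * fourier_kernel N j m) * u m)"
    by (subst sum.swap) (simp add: sum_distrib_right)
  also have "\<dots> = (\<Sum>m<N. if l = m then u m else 0)"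
    using assms by (intro sum.cong) (auto simp: fourier_kernel_orthogonal)
  finally show ?thesis using assms by simp
qed

text \<open>
The kernel is symmetric, so conjugating the other inversion formula gives this one.
\<close>

lemma fourier_inversion_right:
  assumes "l < N"
  shows "kernel_apply (fourier_kernel N) {..<N} (kernel_apply (\<lambda>j l. cnj (fourier_kernel N j l)) {..<N} u) l = u l"
proof -
  have "kernel_apply (fourier_kernel N) {..<N} (kernel_apply (\<lambda>j l. cnj (fourier_kernel N j l)) {..<N} u) l
      = cnj (kernel_apply (\<lambda>j l. cnj (fourier_kernel N j l)) {..<N} (kernel_apply (fourier_kernel N) {..<N} (\<lambda>l. cnj (u l))) l)"
    by (simp add: kernel_apply_def)
  then show ?thesis by (simp add: fourier_inversion[OF assms])
qed

lemma fourier_isometry: "norm_on {..<N} (kernel_apply (fourier_kernel N) {..<N} u) = norm_on {..<N} u"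
proof -
  define v where "v = kernel_apply (fourier_kernel N) {..<N} u"
  have "complex_of_real ((norm_on {..<N} v)\<^sup>2) = (\<Sum>j<N. cnj (v j) * v j)"
    unfolding norm_on_power2 by (simp add: complex_norm_square[symmetric] mult.commute)
  also have "\<dots> = (\<Sum>j<N. \<Sum>l<N. cnj (v j) * (fourier_kernel N j l * u l))"
    by (subst (2) v_def) (simp add: kernel_apply_def sum_distrib_left)
  also have "\<dots> = (\<Sum>l<N. \<Sum>j<N. cnj (v j) * (fourier_kernel N j l * u l))"
    by (rule sum.swap)
  also have "\<dots> = (\<Sum>l<N. u l * cnj (kernel_apply (\<lambda>j l. cnj (fourier_kernel N j l)) {..<N} v l))"
    by (simp add: kernel_apply_def sum_distrib_left mult_ac fourier_kernel_sym[of N])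
  also have "\<dots> = (\<Sum>l<N. u l * cnj (u l))"
    by (intro sum.cong) (auto simp: fourier_inversion v_def)
  also have "\<dots> = complex_of_real ((norm_on {..<N} u)\<^sup>2)"
    unfolding norm_on_power2 by (simp add: complex_norm_square[symmetric])
  finally have "(norm_on {..<N} v)\<^sup>2 = (norm_on {..<N} u)\<^sup>2" using of_real_eq_iff by blast
  then show ?thesis by (simp add: power2_eq_iff_nonneg v_def)
qed

lemma fourier_bound: "kernel_bound {..<N} {..<N} (fourier_kernel N) 1"
  by (simp add: kernel_bound_def fourier_isometry)

text \<open>
The algebra behind the fast Fourier transform: in \<open>(j1 + P j2) (Q l1 + l2) / (P Q)\<close> the term \<open>j2 l1\<close>
is an integer and disappears in the exponential.
\<close>

lemma fourier_kernel_factor: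
  assumes "0 < P" "0 < Q"
  shows "fourier_kernel (P * Q) (j1 + P * j2) (Q * l1 + l2)
    = fourier_kernel P j1 l1 * fourier_kernel Q j2 l2 * cis (- 2 * pi * real j1 * real l2 / real (P * Q))"
proof -
  have "- 2 * pi * real (j1 + P * j2) * real (Q * l1 + l2) / real (P * Q)
      = - (2 * pi * real (j2 * l1)) + (- 2 * pi * real j1 * real l1 / real P
        + - 2 * pi * real j2 * real l2 / real Q + - 2 * pi * real j1 * real l2 / real (P * Q))"
    using assms by (simp add: field_simps)
  then have "cis (- 2 * pi * real (j1 + P * j2) * real (Q * l1 + l2) / real (P * Q))
      = cis (- (2 * pi * real (j2 * l1))) * (cis (- 2 * pi * real j1 * real l1 / real P)
        * cis (- 2 * pi * real j2 * real l2 / real Q) * cis (- 2 * pi * real j1 * real l2 / real (P * Q)))"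
    by (simp only: cis_mult)
  also have "cis (- (2 * pi * real (j2 * l1))) = 1"
    by (metis cis_nat_mult_2pi cis_cnj complex_cnj_one)
  finally show ?thesis
    by (simp add: fourier_kernel_def real_sqrt_mult)
qed

section \<open>Discrete Cantor sets\<close>

lemma sum_lessThan_add: "(\<Sum>j<k + m. f j) = (\<Sum>j<k. f j) + (\<Sum>j<m. f (k + j))" for f :: "nat \<Rightarrow> nat"
  by (induction m) auto

lemma cantor_set_add:
  "cantor_set M A (k + m) = (\<lambda>(c, d). c + M ^ k * d) ` (cantor_set M A k \<times> cantor_set M A m)"
proof (intro equalityI subsetI)
  fix x assume "x \<in> cantor_set M A (k + m)"
  then obtain a where a: "\<forall>j<k + m. a j \<in> A" and x: "x = (\<Sum>j<k + m. a j * M ^ j)"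
    by (auto simp: cantor_set_def)
  have "x = (\<Sum>j<k. a j * M ^ j) + M ^ k * (\<Sum>j<m. a (k + j) * M ^ j)"
    by (simp add: x sum_lessThan_add sum_distrib_left power_add mult_ac)
  moreover have "(\<Sum>j<k. a j * M ^ j) \<in> cantor_set M A k" using a by (auto simp: cantor_set_def)
  moreover have "(\<Sum>j<m. a (k + j) * M ^ j) \<in> cantor_set M A m"
    using a unfolding cantor_set_def by (intro CollectI exI[of _ "\<lambda>j. a (k + j)"]) auto
  ultimately show "x \<in> (\<lambda>(c, d). c + M ^ k * d) ` (cantor_set M A k \<times> cantor_set M A m)" by auto
next
  fix x assume "x \<in> (\<lambda>(c, d). c + M ^ k * d) ` (cantor_set M A k \<times> cantor_set M A m)"
  then obtain a b where a: "\<forall>j<k. a j \<in> A" and b: "\<forall>j<m. b j \<in> A"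
    and x: "x = (\<Sum>j<k. a j * M ^ j) + M ^ k * (\<Sum>j<m. b j * M ^ j)"
    by (auto simp: cantor_set_def)
  define c where "c j = (if j < k then a j else b (j - k))" for j
  have "x = (\<Sum>j<k + m. c j * M ^ j)"
    by (simp add: x sum_lessThan_add c_def sum_distrib_left power_add mult_ac)
  moreover have "\<forall>j<k + m. c j \<in> A" using a b by (auto simp: c_def)
  ultimately show "x \<in> cantor_set M A (k + m)" by (auto simp: cantor_set_def)
qed

lemma cantor_set_0: "cantor_set M A 0 = {0}"
  by (simp add: cantor_set_def)

lemma cantor_set_1: "cantor_set M A 1 = A"
  by (auto simp: cantor_set_def)

lemma cantor_set_less:
  assumes "A \<subseteq> {0..<M}" "c \<in> cantor_set M A k"
  shows "c < M ^ k"
  using assms(2)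
proof (induction k arbitrary: c)
  case (Suc k)
  then obtain d a where c: "c = d + M ^ k * a" and d: "d \<in> cantor_set M A k" and a: "a \<in> A"
    using cantor_set_add[of M A k 1] cantor_set_1[of M A] by auto
  have "d < M ^ k" by (rule Suc.IH[OF d])
  then have "c < M ^ k * Suc a" by (simp add: c)
  also have "\<dots> \<le> M ^ k * M" using a assms(1) by (intro mult_left_mono) auto
  finally show ?case by (simp add: mult.commute)
qed (simp add: cantor_set_0)

lemma cantor_set_subset: "A \<subseteq> {0..<M} \<Longrightarrow> cantor_set M A k \<subseteq> {..<M ^ k}"
  using cantor_set_less by auto

lemma finite_cantor_set: "A \<subseteq> {0..<M} \<Longrightarrow> finite (cantor_set M A k)"
  by (rule finite_subset[OF cantor_set_subset]) auto

lemma inj_on_digits: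
  fixes P :: nat
  assumes "X \<subseteq> {..<P}"
  shows "inj_on (\<lambda>(c, d). c + P * d) (X \<times> Y)"
proof (rule inj_onI, clarsimp)
  fix c d c' d' assume "c \<in> X" "c' \<in> X" and eq: "c + P * d = c' + P * d'"
  then have "c < P" "c' < P" using assms by auto
  then have "c = (c + P * d) mod P" "c' = (c' + P * d') mod P" by auto
  then have "c = c'" using eq by metis
  then show "c = c' \<and> d = d'" using eq \<open>c < P\<close> by auto
qed

lemma card_cantor_set:
  assumes "A \<subseteq> {0..<M}"
  shows "card (cantor_set M A k) = card A ^ k"
proof (induction k)
  case (Suc k)
  have "card (cantor_set M A (k + 1)) = card (cantor_set M A k \<times> A)"
    unfolding cantor_set_add cantor_set_1
    by (intro card_image inj_on_digits cantor_set_subset assms)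
  then show ?case using Suc by (simp add: card_cartesian_product)
qed (simp add: cantor_set_0)

lemma cantor_set_top_digit:
  assumes "A \<subseteq> {0..<M}" "l \<in> cantor_set M A (Suc k)"
  shows "l div M ^ k \<in> A"
proof -
  obtain c a where l: "l = c + M ^ k * a" and c: "c \<in> cantor_set M A k" and a: "a \<in> A"
    using assms(2) cantor_set_add[of M A k 1] cantor_set_1[of M A] by auto
  have "l div M ^ k = a"
    unfolding l using cantor_set_less[OF assms(1) c] by (intro div_nat_eqI) auto
  then show ?thesis using a by simp
qed

section \<open>The Fourier transform between Cantor sets\<close>

text \<open>
The operator norm of \<open>1\<^sub>X K 1\<^sub>X\<close> as a matrix is the norm of the kernel \<open>K\<close> restricted to \<open>X\<close>, in the
form in which it is used: a maximum over the unit ball of \<open>l\<^sup>2(X)\<close>.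
\<close>

lemma op_norm_attained:
  assumes T: "T \<in> carrier_mat N N" and X: "X \<subseteq> {..<N}"
    and entries: "\<And>i j. i < N \<Longrightarrow> j < N \<Longrightarrow> T $$ (i, j) = (if i \<in> X \<and> j \<in> X then K i j else 0)"
  shows "\<exists>u. norm_on X u \<le> 1 \<and> norm_on X (kernel_apply K X u) = op_norm T
    \<and> (\<forall>w. norm_on X w \<le> 1 \<longrightarrow> norm_on X (kernel_apply K X w) \<le> op_norm T)"
proof -
  have fin: "finite X" using X finite_subset by blast
  have apply_T: "l2_norm (T *\<^sub>v w) = norm_on X (kernel_apply K X (\<lambda>i. w $ i))" if w: "w \<in> carrier_vec N" for w
  proof -
    have comp: "(T *\<^sub>v w) $ i = (if i \<in> X then kernel_apply K X (\<lambda>i. w $ i) i else 0)" if i: "i < N" for i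
    proof -
      have "(T *\<^sub>v w) $ i = (\<Sum>j<N. (if i \<in> X \<and> j \<in> X then K i j else 0) * w $ j)"
        using T w i by (auto simp: scalar_prod_def entries atLeast0LessThan intro!: sum.cong)
      also have "\<dots> = (\<Sum>j\<in>X. (if i \<in> X then K i j else 0) * w $ j)"
        using X by (intro sum.mono_neutral_cong_right) auto
      finally show ?thesis by (simp add: kernel_apply_def)
    qed
    have "(\<Sum>i<N. (cmod ((T *\<^sub>v w) $ i))\<^sup>2) = (\<Sum>i\<in>X. (cmod (kernel_apply K X (\<lambda>i. w $ i) i))\<^sup>2)"
      using X comp by (intro sum.mono_neutral_cong_right) auto
    then show ?thesis using T w by (simp add: l2_norm_def norm_on_def L2_set_def)
  qed
  have le: "norm_on X (\<lambda>i. w $ i) \<le> l2_norm w" if "w \<in> carrier_vec N" for w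
  proof -
    have "l2_norm w = norm_on {..<N} (\<lambda>i. w $ i)" using that by (simp add: l2_norm_def norm_on_def L2_set_def)
    then show ?thesis using X by (simp add: norm_on_mono)
  qed
  obtain u where u: "norm_on X u \<le> 1" and max: "\<And>w. norm_on X w \<le> 1 \<Longrightarrow> norm_on X (kernel_apply K X w) \<le> norm_on X (kernel_apply K X u)"
    using kernel_maximiser_exists[OF fin] by metis
  define w where "w = vec N (\<lambda>i. if i \<in> X then u i else 0)"
  have w: "w \<in> carrier_vec N" by (simp add: w_def)
  have wX: "w $ i = u i" if "i \<in> X" for i using that X by (auto simp: w_def)
  have "(\<Sum>i<N. (cmod (w $ i))\<^sup>2) = (\<Sum>i\<in>X. (cmod (u i))\<^sup>2)"
    using X by (intro sum.mono_neutral_cong_right) (auto simp: w_def)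
  then have "l2_norm w = norm_on X u" using w by (simp add: l2_norm_def norm_on_def L2_set_def)
  moreover have "l2_norm (T *\<^sub>v w) = norm_on X (kernel_apply K X u)"
    unfolding apply_T[OF w] by (intro norm_on_cong arg_cong[where f = cmod] kernel_apply_cong) (simp add: wX)
  ultimately have "op_norm T = norm_on X (kernel_apply K X u)"
    unfolding op_norm_def
    using T w u le max by (intro cSup_eq_maximum) (auto simp: apply_T intro!: image_eqI[of _ _ w] max order_trans[OF le])
  then show ?thesis using u max by auto
qed

lemma
  assumes "A \<subseteq> {0..<M}"
  shows cantor_norm_attained: "\<exists>u. norm_on (cantor_set M A k) u \<le> 1 \<and>
    norm_on (cantor_set M A k) (kernel_apply (fourier_kernel (M ^ k)) (cantor_set M A k) u) = cantor_norm M A k"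
    (is ?attained)
  and cantor_norm_bound:
    "kernel_bound (cantor_set M A k) (cantor_set M A k) (fourier_kernel (M ^ k)) (cantor_norm M A k)"
    (is ?bound)
proof -
  let ?N = "M ^ k" and ?C = "cantor_set M A k"
  have C: "?C \<subseteq> {..<?N}" using assms by (rule cantor_set_subset)
  have fin: "finite ?C" using assms by (rule finite_cantor_set)
  have carr: "fourier_mat ?N \<in> carrier_mat ?N ?N" by (simp add: fourier_mat_def)
  have entries: "(indicator_mat ?N ?C * fourier_mat ?N * indicator_mat ?N ?C) $$ (i, j)
      = (if i \<in> ?C \<and> j \<in> ?C then fourier_kernel ?N i j else 0)" if "i < ?N" "j < ?N" for i j
  proof -
    have "indicator_mat ?N ?C * fourier_mat ?N * indicator_mat ?N ?C
        = mat ?N ?N (\<lambda>(i, j). indicator ?C j * (indicator ?C i * fourier_mat ?N $$ (i, j)))"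
      unfolding indicator_mat_def
      by (subst mat_diag_mult_left[OF carr], subst mat_diag_mult_right) (auto simp: mult_ac)
    then show ?thesis using that by (simp add: fourier_mat_index indicator_def)
  qed
  have T: "indicator_mat ?N ?C * fourier_mat ?N * indicator_mat ?N ?C \<in> carrier_mat ?N ?N"
    by (intro mult_carrier_mat[of _ ?N ?N]) (simp_all add: indicator_mat_def fourier_mat_def mat_diag_def)
  have "\<exists>u. norm_on ?C u \<le> 1 \<and> norm_on ?C (kernel_apply (fourier_kernel ?N) ?C u) = cantor_norm M A k
    \<and> (\<forall>w. norm_on ?C w \<le> 1 \<longrightarrow> norm_on ?C (kernel_apply (fourier_kernel ?N) ?C w) \<le> cantor_norm M A k)"
    unfolding cantor_norm_def by (rule op_norm_attained[OF T C]) (rule entries)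
  then obtain u where u: "norm_on ?C u \<le> 1" "norm_on ?C (kernel_apply (fourier_kernel ?N) ?C u) = cantor_norm M A k"
    and max: "\<forall>w. norm_on ?C w \<le> 1 \<longrightarrow> norm_on ?C (kernel_apply (fourier_kernel ?N) ?C w) \<le> cantor_norm M A k"
    by (elim exE conjE)
  show ?attained by (rule exI[of _ u], rule conjI, rule u(1), rule u(2))
  show ?bound
  proof (rule kernel_boundI_unit[OF fin])
    fix w assume "norm_on ?C w \<le> 1"
    then show "norm_on ?C (kernel_apply (fourier_kernel ?N) ?C w) \<le> cantor_norm M A k"
      by (rule max[THEN spec, THEN mp])
  qed
qed

lemma cantor_norm_le:
  assumes "A \<subseteq> {0..<M}" "0 \<le> r"
    "kernel_bound (cantor_set M A k) (cantor_set M A k) (fourier_kernel (M ^ k)) r"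
  shows "cantor_norm M A k \<le> r"
proof -
  from cantor_norm_attained[OF assms(1), of k]
  obtain u where u: "norm_on (cantor_set M A k) u \<le> 1"
    "norm_on (cantor_set M A k) (kernel_apply (fourier_kernel (M ^ k)) (cantor_set M A k) u) = cantor_norm M A k"
    by (elim exE conjE)
  then have "cantor_norm M A k \<le> r * norm_on (cantor_set M A k) u"
    using kernel_boundD[OF assms(3), of u] by simp
  also have "\<dots> \<le> r" using u assms(2) by (simp add: mult_left_le)
  finally show ?thesis .
qed

lemma cantor_norm_nonneg:
  assumes "A \<subseteq> {0..<M}"
  shows "0 \<le> cantor_norm M A k"
proof -
  from cantor_norm_attained[OF assms, of k]
  obtain u where "norm_on (cantor_set M A k) (kernel_apply (fourier_kernel (M ^ k)) (cantor_set M A k) u) = cantor_norm M A k"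
    by (elim exE conjE)
  then show ?thesis by (metis norm_on_nonneg)
qed

text \<open>
A single entry of the Fourier matrix has modulus \<open>1 / sqrt N\<close>.  Only a power of \<open>N\<close> matters here: it
makes the logarithms of the norms meaningful and keeps the limit finite.
\<close>

lemma cantor_norm_lower:
  assumes A: "A \<subseteq> {0..<M}" "A \<noteq> {}"
  shows "1 / sqrt (real (M ^ k)) \<le> cantor_norm M A k"
proof -
  let ?C = "cantor_set M A k" and ?K = "fourier_kernel (M ^ k)"
  have fin: "finite ?C" by (rule finite_cantor_set[OF A(1)])
  have "card ?C \<noteq> 0" using A finite_subset[OF A(1)] by (simp add: card_cantor_set card_eq_0_iff)
  then obtain c where c: "c \<in> ?C" by fastforce
  define d where "d l = (if l = c then 1 else 0 :: complex)" for l
  have "norm_on ?C d = 1"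
    using fin c by (simp add: norm_on_def L2_set_def d_def if_distrib[of "\<lambda>x. (cmod x)\<^sup>2"] cong: if_cong)
  moreover have "kernel_apply ?K ?C d = (\<lambda>j. ?K j c)"
    using fin c by (auto simp: kernel_apply_def d_def if_distrib[of "\<lambda>x. _ * x"] cong: if_cong)
  ultimately have "norm_on ?C (\<lambda>j. ?K j c) \<le> cantor_norm M A k"
    using kernel_boundD[OF cantor_norm_bound[OF A(1), of k], of d] by simp
  moreover have "norm_on {c} (\<lambda>j. ?K j c) \<le> norm_on ?C (\<lambda>j. ?K j c)"
    using fin c by (intro norm_on_mono) auto
  ultimately show ?thesis by (simp add: norm_on_def norm_fourier_kernel)
qed

lemma cantor_norm_submult:
  assumes A: "A \<subseteq> {0..<M}" and M: "0 < M"
  shows "cantor_norm M A (k + m) \<le> cantor_norm M A k * cantor_norm M A m"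
proof (rule cantor_norm_le[OF A])
  let ?C = "cantor_set M A"
  let ?f = "\<lambda>(j1, j2). j1 + M ^ k * j2" and ?g = "\<lambda>(l1, l2). M ^ m * l1 + l2"
  have fin: "finite (?C i)" for i by (rule finite_cantor_set[OF A])
  show "0 \<le> cantor_norm M A k * cantor_norm M A m" using A by (simp add: cantor_norm_nonneg)
  have J: "?C (k + m) = ?f ` (?C k \<times> ?C m)" by (rule cantor_set_add)
  have "?C (k + m) = (\<lambda>(c, d). c + M ^ m * d) ` (?C m \<times> ?C k)"
    by (subst add.commute) (rule cantor_set_add)
  also have "\<dots> = ?g ` (?C k \<times> ?C m)" by (force simp: add.commute)
  finally have L: "?C (k + m) = ?g ` (?C k \<times> ?C m)" .
  have f: "inj_on ?f (?C k \<times> ?C m)" by (intro inj_on_digits cantor_set_subset A)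
  have g: "inj_on ?g (?C k \<times> ?C m)"
    using inj_on_digits[OF cantor_set_subset[OF A], of m "?C k"]
    by (force simp: inj_on_def add.commute)
  have "kernel_bound (?f ` (?C k \<times> ?C m)) (?g ` (?C k \<times> ?C m)) (fourier_kernel (M ^ (k + m)))
      (cantor_norm M A k * cantor_norm M A m)"
    unfolding kernel_bound_reindex[OF f g]
  proof (subst kernel_bound_cong)
    show "kernel_bound (?C k \<times> ?C m) (?C k \<times> ?C m)
      (\<lambda>(j1, j2) (l1, l2). fourier_kernel (M ^ k) j1 l1 * fourier_kernel (M ^ m) j2 l2
         * cis (- 2 * pi * real j1 * real l2 / real (M ^ k * M ^ m)))
      (cantor_norm M A k * cantor_norm M A m)"
      by (intro kernel_bound_tensor cantor_norm_bound cantor_norm_nonneg fin A) simp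
  qed (use M in \<open>auto simp: power_add fourier_kernel_factor simp del: of_nat_mult of_nat_power\<close>)
  then show "kernel_bound (?C (k + m)) (?C (k + m)) (fourier_kernel (M ^ (k + m)))
      (cantor_norm M A k * cantor_norm M A m)"
    using J L by simp
qed

section \<open>The uncertainty exponent\<close>

text \<open>
Fekete's lemma.  For fixed \<open>p\<close>, division of \<open>n\<close> by \<open>p\<close> with remainder bounds \<open>a n / n\<close> by \<open>a p / p\<close> up
to an error \<open>B / n\<close>, so the limit is the infimum, and in particular it bounds every
term from below.
\<close>

lemma fekete_subadditive:
  fixes a :: "nat \<Rightarrow> real"
  assumes sub: "\<And>m n. a (m + n) \<le> a m + a n" and low: "\<And>n. - (c * real n) \<le> a n"
  shows "\<exists>L. (\<lambda>n. a n / real n) \<longlonglongrightarrow> L \<and> (\<forall>n>0. L \<le> a n / real n)"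
proof -
  define S where "S = (\<lambda>n. a n / real n) ` {0<..}"
  define L where "L = Inf S"
  have bdd: "bdd_below S"
  proof (rule bdd_belowI)
    fix x assume "x \<in> S"
    then obtain n where "0 < n" "x = a n / real n" by (auto simp: S_def)
    moreover from this have "(- c) * real n \<le> x * real n" using low[of n] by (simp add: field_simps)
    ultimately show "- c \<le> x" by (simp only: mult_le_cancel_right_pos of_nat_0_less_iff)
  qed
  have lower: "L \<le> a n / real n" if "0 < n" for n
    unfolding L_def using that by (intro cInf_lower bdd) (auto simp: S_def)
  have mult: "a (q * p + s) \<le> real q * a p + a s" for q p s
  proof (induction q)
    case (Suc q)
    have "a (p + (q * p + s)) \<le> a p + (real q * a p + a s)"
      using sub[of p "q * p + s"] Suc by linarith
    then show ?case by (simp add: algebra_simps)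
  qed simp
  have "(\<lambda>n. a n / real n) \<longlonglongrightarrow> L"
  proof (rule LIMSEQ_I)
    fix e :: real assume e: "0 < e"
    have "Inf S < L + e / 2" using e by (simp add: L_def)
    then obtain p where p: "0 < p" "a p / real p < L + e / 2"
      by (subst (asm) cInf_less_iff[OF _ bdd]) (auto simp: S_def)
    \<comment> \<open>An upper bound for the effect of the remainder, uniform in \<open>n\<close>.\<close>
    define B where "B = \<bar>a p\<bar> + (\<Sum>s<p. \<bar>a s\<bar>)"
    have B: "0 \<le> B" by (simp add: B_def sum_nonneg)
    obtain n0 :: nat where n0: "2 * B / e < real n0" using reals_Archimedean2 by blast
    have "norm (a n / real n - L) < e" if n: "max 1 n0 \<le> n" for n
    proof -
      define q s where "q = n div p" and "s = n mod p"
      have nqs: "n = q * p + s" and "s < p" using p by (auto simp: q_def s_def)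
      have "\<bar>a s\<bar> \<le> (\<Sum>s<p. \<bar>a s\<bar>)" using \<open>s < p\<close> by (intro member_le_sum) auto
      moreover have "a n \<le> real q * a p + a s" using mult[of q p s] nqs by simp
      moreover have "real q * a p \<le> real n * (a p / real p) + \<bar>a p\<bar>"
      proof -
        have "real n = real q * real p + real s" unfolding nqs by simp
        then have "real q * a p = real n * (a p / real p) - (real s / real p) * a p"
          using p by (simp add: field_simps)
        moreover have "\<bar>(real s / real p) * a p\<bar> \<le> 1 * \<bar>a p\<bar>"
          unfolding abs_mult using \<open>s < p\<close> by (intro mult_right_mono) auto
        ultimately show ?thesis by linarith
      qed
      ultimately have "a n \<le> real n * (a p / real p) + B" unfolding B_def by linarith
      then have "a n / real n \<le> a p / real p + B / real n"
        using n by (simp add: field_simps)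
      moreover have "B / real n < e / 2"
      proof -
        have "2 * B / e < real n" using n0 n by linarith
        then show ?thesis using e n by (simp add: field_simps)
      qed
      ultimately have "a n / real n < L + e" using p by linarith
      moreover have "L \<le> a n / real n" using lower n by simp
      ultimately show ?thesis by simp
    qed
    then show "\<exists>n0. \<forall>n\<ge>n0. norm (a n / real n - L) < e" by blast
  qed
  then show ?thesis using lower by blast
qed

text \<open>
If the norm were 1, an extremal \<open>u\<close> would be supported on the Cantor set together with its Fourier
transform, by unitarity.  The points with a leading digit \<open>g\<close> outside \<open>A\<close> form an interval free of
Cantor points; rotating it to the end of \<open>{0..<N}\<close> makes the Fourier transform of \<open>u\<close>, up to a
phase, a polynomial of degree below \<open>N - M^k\<close>.  It vanishes at the \<open>N - |A|^(k+1)\<close> roots of unity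
that correspond to points outside the Cantor set, which is too many for a nonzero polynomial.
\<close>

lemma cantor_norm_less_1:
  assumes A: "A \<subseteq> {0..<M}" "card A < M" and small: "card A ^ Suc k \<le> M ^ k" and M: "1 < M"
  shows "cantor_norm M A (Suc k) < 1"
proof (rule ccontr)
  assume "\<not> cantor_norm M A (Suc k) < 1"
  then have ge: "1 \<le> cantor_norm M A (Suc k)" by simp
  define N n where "N = M ^ Suc k" and "n = M ^ k"
  have Nn: "N = M * n" and npos: "0 < n" using M by (auto simp: N_def n_def)
  define C where "C = cantor_set M A (Suc k)"
  have CN: "C \<subseteq> {..<N}" unfolding C_def N_def by (rule cantor_set_subset[OF A(1)])
  have fin: "finite C" unfolding C_def by (rule finite_cantor_set[OF A(1)])
  from cantor_norm_attained[OF A(1), of "Suc k"]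
  obtain u where u1: "norm_on C u \<le> 1" and u2: "norm_on C (kernel_apply (fourier_kernel N) C u) = cantor_norm M A (Suc k)"
    unfolding C_def N_def by (elim exE conjE)
  define v where "v = kernel_apply (fourier_kernel N) C u"
  define w where "w l = (if l \<in> C then u l else 0)" for l
  have vw: "v = kernel_apply (fourier_kernel N) {..<N} w"
    unfolding v_def kernel_apply_def w_def using CN
    by (intro ext sum.mono_neutral_cong_left) auto
  have nw: "norm_on {..<N} w = norm_on C u"
  proof -
    have "(\<Sum>l<N. (cmod (w l))\<^sup>2) = (\<Sum>l\<in>C. (cmod (u l))\<^sup>2)"
      using CN by (intro sum.mono_neutral_cong_right) (auto simp: w_def)
    then show ?thesis by (simp add: norm_on_def L2_set_def)
  qed
  have nv: "norm_on {..<N} v \<le> 1" unfolding vw fourier_isometry nw by (rule u1)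
  have vC: "1 \<le> norm_on C v" using u2 ge by (simp add: v_def)
  \<comment> \<open>Unitarity leaves no mass for the Fourier transform outside the Cantor set.\<close>
  have "(norm_on {..<N} v)\<^sup>2 = (norm_on C v)\<^sup>2 + (norm_on ({..<N} - C) v)\<^sup>2"
    unfolding norm_on_power2 using CN by (subst sum.subset_diff[OF CN]) auto
  moreover have "(norm_on {..<N} v)\<^sup>2 \<le> 1" using nv by (simp add: power_le_one)
  moreover have "1 \<le> (norm_on C v)\<^sup>2" using vC by simp
  ultimately have "(norm_on ({..<N} - C) v)\<^sup>2 \<le> 0" by linarith
  then have "norm_on ({..<N} - C) v = 0" by simp
  then have v0: "v j = 0" if "j \<in> {..<N} - C" for j using that by (simp add: norm_on_eq_0_iff)
  obtain g where g: "g < M" "g \<notin> A"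
  proof -
    have "\<not> {0..<M} \<subseteq> A" using card_mono[of A "{0..<M}"] A finite_subset[OF A(1)] by auto
    then obtain g where "g \<in> {0..<M}" "g \<notin> A" by blast
    then show thesis using that by simp
  qed
  have gn: "Suc g * n \<le> N" unfolding Nn using g by (intro mult_right_mono) auto
  \<comment> \<open>The position of \<open>l\<close> after the cyclic shift that moves the gap to the top of \<open>{0..<N}\<close>.\<close>
  define e where "e l = (if l < g * n then l + (N - Suc g * n) else l - Suc g * n)" for l
  have gap: "l < g * n \<or> Suc g * n \<le> l" if "l \<in> C" for l
  proof -
    have "l div n \<in> A" using cantor_set_top_digit[OF A(1)] that by (simp add: C_def n_def)
    then have "l div n < g \<or> Suc g \<le> l div n" using g by (metis not_less_eq_eq linorder_neqE_nat Suc_leI)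
    then show ?thesis using npos
      by (metis less_eq_div_iff_mult_less_eq div_less_iff_less_mult)
  qed
  have e_less: "e l < N - n" if "l \<in> C" for l
  proof -
    have "l < N" using CN that by auto
    then show ?thesis using gap[OF that] gn npos by (auto simp: e_def)
  qed
  have e_inj: "inj_on e C"
  proof (rule inj_onI)
    fix l m assume "l \<in> C" "m \<in> C" "e l = e m"
    moreover have "l < N" "m < N" using CN \<open>l \<in> C\<close> \<open>m \<in> C\<close> by auto
    ultimately show "l = m" using gap[of l] gap[of m] gn by (auto simp: e_def split: if_splits)
  qed
  have e_pow: "z ^ e l * z ^ (Suc g * n) = z ^ l" if "l \<in> C" "z ^ N = 1" for l and z :: complex
  proof (cases "l < g * n")
    case True
    then have "e l + Suc g * n = l + N" using gn by (simp add: e_def)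
    then show ?thesis using that by (metis power_add mult.right_neutral)
  next
    case False
    then have "e l + Suc g * n = l" using gap[OF that(1)] by (simp add: e_def)
    then show ?thesis by (metis power_add)
  qed
  define p where "p = (\<Sum>l\<in>C. monom (u l) (e l))"
  define z where "z j = cnj (cis (2 * pi * real j / real N))" for j :: nat
  have N0: "0 < N" using npos M by (simp add: Nn)
  have zN: "z j ^ N = 1" for j
  proof -
    have "cis (2 * pi * real j / real N) ^ N = 1" using N0 by (simp add: Complex.DeMoivre)
    then show ?thesis unfolding z_def by (metis complex_cnj_power complex_cnj_one)
  qed
  have root: "poly p (z j) = 0" if "j \<in> {..<N} - C" for j
  proof -
    have kz: "fourier_kernel N j l = z j ^ l / complex_of_real (sqrt (real N))" for l
      by (simp add: fourier_kernel_def z_def Complex.DeMoivre cis_cnj mult_ac)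
    have "poly p (z j) * z j ^ (Suc g * n) = (\<Sum>l\<in>C. u l * (z j ^ e l * z j ^ (Suc g * n)))"
      by (simp only: p_def poly_sum poly_monom sum_distrib_right mult.assoc)
    also have "\<dots> = (\<Sum>l\<in>C. u l * z j ^ l)" using e_pow zN by (intro sum.cong) auto
    also have "\<dots> = complex_of_real (sqrt (real N)) * v j"
      using N0 unfolding v_def kernel_apply_def kz by (simp add: sum_distrib_left mult_ac)
    also have "\<dots> = 0" using v0[OF that] by simp
    finally show ?thesis by (simp add: z_def)
  qed
  have "p = 0"
  proof (rule ccontr)
    assume p: "p \<noteq> 0"
    have "inj_on (\<lambda>j. cis (2 * pi * real j / real N)) {..<N}"
      using Complex.bij_betw_roots_unity[OF N0] by (rule bij_betw_imp_inj_on)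
    then have "inj_on z ({..<N} - C)" by (auto simp: inj_on_def z_def)
    then have "card ({..<N} - C) = card (z ` ({..<N} - C))" by (simp add: card_image)
    also have "\<dots> \<le> card {x. poly p x = 0}"
      using root poly_roots_finite[OF p] by (intro card_mono) auto
    also have "\<dots> \<le> degree p" by (rule card_poly_roots_bound[OF p])
    also have "\<dots> < N - n"
      unfolding p_def
    proof (rule degree_sum_less)
      show "degree (monom (u l) (e l)) < N - n" if "l \<in> C" for l
        using e_less[OF that] degree_monom_le[of "u l" "e l"] by linarith
      show "0 < N - n" using npos M by (simp add: Nn)
    qed
    also have "N - n \<le> N - card C"
      using small by (simp add: C_def card_cantor_set[OF A(1)] n_def)
    also have "\<dots> = card ({..<N} - C)" using fin CN by (simp add: card_Diff_subset)
    finally show False by simp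
  qed
  have "u l = 0" if "l \<in> C" for l
  proof -
    have "coeff p (e l) = (\<Sum>m\<in>C. if m = l then u m else 0)"
      unfolding p_def coeff_sum using e_inj that by (intro sum.cong) (auto simp: inj_on_def)
    then show ?thesis using fin that \<open>p = 0\<close> by simp
  qed
  then have "v = (\<lambda>j. 0)" by (auto simp: v_def kernel_apply_def)
  then show False using vC by (simp add: norm_on_def L2_set_def)
qed

text \<open>
The deviation of \<open>x\<close> from its mean has square norm equal to the defect in Cauchy-Schwarz against the
constant function.
\<close>

lemma Cauchy_Schwarz_equality:
  fixes x :: "'a \<Rightarrow> complex"
  assumes fin: "finite C" and eq: "(cmod (\<Sum>l\<in>C. x l))\<^sup>2 = card C * (\<Sum>l\<in>C. (cmod (x l))\<^sup>2)" and l: "l \<in> C"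
  shows "x l = (\<Sum>l\<in>C. x l) / of_nat (card C)"
proof -
  define s where "s = (\<Sum>l\<in>C. x l)"
  define c where "c = real (card C)"
  have c: "0 < c" using fin l by (auto simp: c_def card_gt_0_iff)
  define m where "m = s / of_real c"
  have "complex_of_real (\<Sum>l\<in>C. (cmod (x l - m))\<^sup>2) = (\<Sum>l\<in>C. (x l - m) * cnj (x l - m))"
    by (simp only: of_real_sum complex_norm_square)
  also have "\<dots> = (\<Sum>l\<in>C. x l * cnj (x l)) - s * cnj m - m * cnj s + of_nat (card C) * (m * cnj m)"
    by (simp add: algebra_simps sum.distrib sum_subtractf s_def sum_distrib_left sum_distrib_right)
  also have "\<dots> = (\<Sum>l\<in>C. x l * cnj (x l)) - s * cnj s / of_real c"
  proof -
    have "of_nat (card C) = complex_of_real c" by (simp add: c_def)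
    then show ?thesis using c by (simp add: m_def field_simps)
  qed
  also have "(\<Sum>l\<in>C. x l * cnj (x l)) = complex_of_real (\<Sum>l\<in>C. (cmod (x l))\<^sup>2)"
    by (simp only: of_real_sum complex_norm_square)
  also have "s * cnj s = complex_of_real (c * (\<Sum>l\<in>C. (cmod (x l))\<^sup>2))"
    using eq unfolding s_def[symmetric] c_def by (simp only: complex_norm_square[symmetric])
  finally have "complex_of_real (\<Sum>l\<in>C. (cmod (x l - m))\<^sup>2) = 0" using c by simp
  then have "(\<Sum>l\<in>C. (cmod (x l - m))\<^sup>2) = 0" by (simp only: of_real_eq_0_iff)
  then have "cmod (x l - m) = 0" using fin l by (simp add: sum_nonneg_eq_0_iff)
  then show ?thesis by (simp add: m_def s_def c_def)
qed

text \<open>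
The right-hand side is the Hilbert-Schmidt norm.  If it were attained at \<open>u\<close>, Cauchy-Schwarz would be
an equality in every row, so \<open>K j l * u l\<close> would not depend on \<open>l\<close>, and all 2 by 2 minors of the
matrix would vanish.  For two points that differ only in the lowest digit, by \<open>d\<close> with \<open>0 < d < M\<close>,
this says that \<open>d^2 / M^2\<close> is an integer.  One digit would not be enough: \<open>d^2 / M\<close> can be an
integer, for instance for \<open>M = 4\<close> and \<open>A = {0, 2}\<close>.
\<close>

lemma cantor_norm_2_less:
  assumes A: "A \<subseteq> {0..<M}" "1 < card A"
  shows "cantor_norm M A 2 < real (card A) ^ 2 / real M"
proof (rule ccontr)
  define C where "C = cantor_set M A 2"
  define K where "K = fourier_kernel (M ^ 2)"
  define c where "c = real (card C)"
  assume "\<not> cantor_norm M A 2 < real (card A) ^ 2 / real M"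
  then have ge: "c / real M \<le> cantor_norm M A 2"
    by (simp add: c_def C_def card_cantor_set[OF A(1)])
  have fin: "finite C" unfolding C_def by (rule finite_cantor_set[OF A(1)])
  have c: "0 < c" using A by (simp add: c_def C_def card_cantor_set[OF A(1)])
  have M: "0 < M" using A by (cases M) auto
  have normK: "cmod (K j l) = 1 / real M" for j l by (simp add: K_def norm_fourier_kernel)
  from cantor_norm_attained[OF A(1), of 2]
  obtain u where u1: "norm_on C u \<le> 1" and u2: "norm_on C (kernel_apply K C u) = cantor_norm M A 2"
    unfolding C_def K_def by (elim exE conjE)
  define v where "v = kernel_apply K C u"
  have nrmK: "norm_on C (K j) = sqrt c / real M" for j
    by (simp add: norm_on_def normK L2_set_constant c_def)
  have row: "cmod (v j) \<le> sqrt c / real M * norm_on C u" for j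
    unfolding v_def kernel_apply_def using Cauchy_Schwarz_nrm[where J = C and u = "K j" and v = u] nrmK by simp
  have row2: "(cmod (v j))\<^sup>2 \<le> c / (real M)\<^sup>2 * (norm_on C u)\<^sup>2" for j
  proof -
    have "(cmod (v j))\<^sup>2 \<le> (sqrt c / real M * norm_on C u)\<^sup>2" by (intro power_mono row) auto
    then show ?thesis using c by (simp add: power_mult_distrib power_divide)
  qed
  have nu: "(norm_on C u)\<^sup>2 \<le> 1" using u1 by (simp add: power_le_one)
  have row3: "c / (real M)\<^sup>2 * (norm_on C u)\<^sup>2 \<le> c / (real M)\<^sup>2" using nu c by (intro mult_left_le) auto
  have "(c / real M)\<^sup>2 \<le> (cantor_norm M A 2)\<^sup>2" using ge c by (intro power_mono) auto
  also have "\<dots> = (\<Sum>j\<in>C. (cmod (v j))\<^sup>2)" unfolding u2[symmetric] norm_on_power2 v_def by simp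
  finally have tot: "(\<Sum>j\<in>C. c / (real M)\<^sup>2) \<le> (\<Sum>j\<in>C. (cmod (v j))\<^sup>2)"
    by (simp add: c_def power2_eq_square)
  have vj: "(cmod (v j))\<^sup>2 = c / (real M)\<^sup>2" if "j \<in> C" for j
  proof (rule sum_mono_inv[where f = "\<lambda>j. (cmod (v j))\<^sup>2" and g = "\<lambda>j. c / (real M)\<^sup>2" and I = C])
    show le: "(cmod (v j))\<^sup>2 \<le> c / (real M)\<^sup>2" for j by (rule order_trans[OF row2 row3])
    show "(\<Sum>j\<in>C. (cmod (v j))\<^sup>2) = (\<Sum>j\<in>C. c / (real M)\<^sup>2)"
      by (rule antisym[OF sum_mono[OF le] tot])
  qed (use that fin in auto)
  have const: "K j l * u l = v j / of_nat (card C)" if jl: "j \<in> C" "l \<in> C" for j l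
  proof -
    have "c / (real M)\<^sup>2 \<le> c / (real M)\<^sup>2 * (norm_on C u)\<^sup>2" using row2[of j] vj[OF jl(1)] by simp
    then have n1: "(norm_on C u)\<^sup>2 = 1" using nu c M by (simp add: field_simps)
    have "(\<Sum>l\<in>C. (cmod (K j l * u l))\<^sup>2) = (norm_on C u)\<^sup>2 / (real M)\<^sup>2"
      by (simp add: norm_mult normK power_mult_distrib power_divide norm_on_power2 sum_divide_distrib)
    then have "(cmod (\<Sum>l\<in>C. K j l * u l))\<^sup>2 = card C * (\<Sum>l\<in>C. (cmod (K j l * u l))\<^sup>2)"
      using vj[OF jl(1)] n1 by (simp add: v_def kernel_apply_def c_def)
    from Cauchy_Schwarz_equality[OF fin this jl(2)]
    show ?thesis by (simp add: v_def kernel_apply_def)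
  qed
  have nz: "u l \<noteq> 0" if "l \<in> C" for l
  proof
    assume "u l = 0"
    then have "v l = 0" using const[OF that that] c by (simp add: c_def)
    then show False using vj[OF that] c M by simp
  qed
  obtain a b where ab: "a \<in> A" "b \<in> A" "a < b"
  proof -
    obtain a b where "a \<in> A" "b \<in> A" "a \<noteq> b"
      using A(2) by (metis card_le_Suc0_iff_eq card_eq_0_iff leD not_less_zero One_nat_def)
    then show thesis using that by (metis linorder_neqE_nat)
  qed
  have mem: "d + M * a \<in> C" if "d \<in> A" for d
  proof -
    have "(d, a) \<in> cantor_set M A 1 \<times> cantor_set M A 1" unfolding cantor_set_1 using that ab by simp
    then have "d + M ^ 1 * a \<in> cantor_set M A (1 + 1)" unfolding cantor_set_add by force
    then show ?thesis by (simp add: C_def numeral_2_eq_2)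
  qed
  define j l where "j = a + M * a" and "l = b + M * a"
  have jC: "j \<in> C" and lC: "l \<in> C" using mem ab by (auto simp: j_def l_def)
  have e1: "K j j * u j = K j l * u l" and e2: "K l j * u j = K l l * u l"
    using const jC lC by metis+
  have "(K j j * u j) * (K l l * u l) = (K j l * u l) * (K l j * u j)"
    by (simp only: e1 e2)
  then have "(K j j * K l l) * (u j * u l) = (K j l * K l j) * (u j * u l)"
    by (simp only: mult_ac)
  then have eq: "K j j * K l l = K j l * K l j" using nz[OF jC] nz[OF lC] by simp
  define t where "t x = - 2 * pi * x / real (M ^ 2)" for x
  have Kcis: "K x y = cis (t (real x * real y)) / of_real (real M)" for x y
    by (simp add: K_def fourier_kernel_def t_def mult.assoc)
  have "cis (t (real j * real j) + t (real l * real l)) = cis (t (real j * real l) + t (real l * real j))"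
    using eq M unfolding Kcis by (simp add: cis_mult[symmetric])
  then have "cis (t (real j * real j) + t (real l * real l)) * cis (- (t (real j * real l) + t (real l * real j))) = 1"
    by (metis cis_mult add.right_inverse cis_zero)
  then have "cis (- (t (real j * real j) + t (real l * real l) - (t (real j * real l) + t (real l * real j)))) = 1"
    unfolding cis_mult by (metis cis_cnj complex_cnj_one diff_conv_add_uminus)
  moreover have "- (t (real j * real j) + t (real l * real l) - (t (real j * real l) + t (real l * real j)))
      = 2 * pi * ((real l - real j) / real M)\<^sup>2"
    using M by (simp add: t_def field_simps power2_eq_square)
  ultimately have int: "((real l - real j) / real M)\<^sup>2 \<in> \<int>" by (simp only: cis_2pi_eq_1_iff)
  have lj: "real l - real j = real b - real a" by (simp add: j_def l_def)
  have "b < M" using A(1) ab by auto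
  then have pos: "0 < (real l - real j) / real M" and lt: "(real l - real j) / real M < 1"
    using ab unfolding lj by auto
  have "((real l - real j) / real M)\<^sup>2 < 1\<^sup>2"
    by (rule power_strict_mono[OF lt less_imp_le[OF pos]]) simp
  moreover have "((real l - real j) / real M)\<^sup>2 \<noteq> 0" by (rule power_not_zero[OF less_imp_neq[OF pos, symmetric]])
  ultimately show False using Ints_nonzero_abs_ge1[OF int] by simp
qed

lemma cantor_exponent:
  assumes A: "A \<subseteq> {0..<M}" "1 < card A" "card A < M"
  shows "\<exists>\<beta>. (\<lambda>k. - (ln (cantor_norm M A k) / (real k * ln (real M)))) \<longlonglongrightarrow> \<beta> \<and>
    \<beta> > max 0 (1 / 2 - cantor_dim M A)"
proof -
  define a where "a k = ln (cantor_norm M A k)" for k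
  have M: "1 < M" using A by linarith
  have lnM: "0 < ln (real M)" using M by simp
  have A0: "A \<noteq> {}" using A by auto
  have lower: "1 / sqrt (real (M ^ k)) \<le> cantor_norm M A k" for k
    by (rule cantor_norm_lower[OF A(1) A0])
  have pos: "0 < cantor_norm M A k" for k
    by (rule less_le_trans[OF _ lower]) (use M in auto)
  have sub: "a (m + n) \<le> a m + a n" for m n
  proof -
    have "a (m + n) \<le> ln (cantor_norm M A m * cantor_norm M A n)"
      unfolding a_def using cantor_norm_submult[OF A(1), of m n] M pos by (intro ln_mono) auto
    then show ?thesis using pos[of m] pos[of n] by (simp add: a_def ln_mult)
  qed
  have low: "- (ln (real M) / 2 * real k) \<le> a k" for k
  proof -
    have "ln (1 / sqrt (real (M ^ k))) \<le> a k"
      unfolding a_def using lower[of k] M pos by (intro ln_mono) auto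
    then show ?thesis using M by (simp add: ln_div ln_sqrt ln_realpow mult.commute)
  qed
  obtain L where L: "(\<lambda>k. a k / real k) \<longlonglongrightarrow> L" and Lle: "\<And>k. 0 < k \<Longrightarrow> L \<le> a k / real k"
    using fekete_subadditive[of a, OF sub low] by blast
  define \<beta> where "\<beta> = - (L / ln (real M))"
  have "(\<lambda>k. - (a k / real k / ln (real M))) \<longlonglongrightarrow> \<beta>"
    unfolding \<beta>_def using lnM by (intro tendsto_intros L) auto
  then have lim: "(\<lambda>k. - (ln (cantor_norm M A k) / (real k * ln (real M)))) \<longlonglongrightarrow> \<beta>"
    by (simp add: a_def)
  have beta: "t < \<beta>" if k: "0 < k" and "cantor_norm M A k < real M powr (- (t * real k))" for t k
  proof -
    have "a k < ln (real M powr (- (t * real k)))"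
      unfolding a_def using that pos M by (intro ln_less_cancel_iff[THEN iffD2]) auto
    then have "a k < - (t * real k) * ln (real M)" using M by (simp add: ln_powr)
    then have "a k / real k < - t * ln (real M)" using k by (simp add: field_simps)
    then have "L < - t * ln (real M)" using Lle[OF k] by linarith
    then show ?thesis using lnM by (simp add: \<beta>_def field_simps)
  qed
  have "0 < \<beta>"
  proof -
    have "(\<lambda>k. (real (card A) / real M) ^ k) \<longlonglongrightarrow> 0"
      using A by (intro LIMSEQ_power_zero) auto
    then have "\<forall>\<^sub>F k in sequentially. (real (card A) / real M) ^ k < 1 / real (card A)"
      using A by (intro order_tendstoD) auto
    then obtain k where "(real (card A) / real M) ^ k < 1 / real (card A)"
      by (auto simp: eventually_sequentially)
    then have "real (card A ^ Suc k) \<le> real (M ^ k)"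
      using A M by (simp add: power_divide field_simps)
    then have "card A ^ Suc k \<le> M ^ k" by (simp only: of_nat_le_iff)
    then have "cantor_norm M A (Suc k) < 1" by (rule cantor_norm_less_1[OF A(1,3) _ M])
    then show ?thesis using beta[of "Suc k" 0] M by simp
  qed
  moreover have "1 / 2 - cantor_dim M A < \<beta>"
  proof -
    have "real M powr (- ((1 / 2 - cantor_dim M A) * real 2))
        = (real M powr cantor_dim M A) ^ 2 / real M"
      using M by (simp add: powr_realpow[symmetric] powr_powr powr_diff algebra_simps flip: powr_realpow)
    also have "real M powr cantor_dim M A = real (card A)"
      using A M lnM by (simp add: cantor_dim_def powr_def)
    finally show ?thesis using beta[of 2] cantor_norm_2_less[OF A(1,2)] by simp
  qed
  ultimately show ?thesis using lim by (intro exI[of _ \<beta>]) simp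
qed

lemma cantor_norm_eventually_le:
  assumes A: "A \<subseteq> {0..<M}" "A \<noteq> {}" and M: "2 \<le> M"
    and lim: "(\<lambda>k. - (ln (cantor_norm M A k) / (real k * ln (real M)))) \<longlonglongrightarrow> \<beta>" and b: "b < \<beta>"
  shows "\<forall>\<^sub>F k in sequentially. cantor_norm M A k \<le> real M powr (- (b * real k))"
proof -
  have lnM: "0 < ln (real M)" using M by simp
  have pos: "0 < cantor_norm M A k" for k
    by (rule less_le_trans[OF _ cantor_norm_lower[OF A]]) (use M in auto)
  have "\<forall>\<^sub>F k in sequentially. b < - (ln (cantor_norm M A k) / (real k * ln (real M)))"
    by (rule order_tendstoD(1)[OF lim b])
  then show ?thesis using eventually_gt_at_top[of 0]
  proof eventually_elim
    case (elim k)
    have "ln (cantor_norm M A k) \<le> - (b * real k) * ln (real M)"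
      using elim lnM by (simp add: field_simps)
    then have "exp (ln (cantor_norm M A k)) \<le> exp (- (b * real k) * ln (real M))" by simp
    then show ?case using pos[of k] M by (simp add: powr_def)
  qed
qed

section \<open>Finite differences of smooth cutoffs\<close>

definition backward_diff :: "real \<Rightarrow> (real \<Rightarrow> real) \<Rightarrow> real \<Rightarrow> real" where
  "backward_diff h f x = f x - f (x - h)"

text \<open>
The boundary terms vanish because \<open>f\<close> is supported in \<open>[0, n h)\<close>; each differencing step enlarges the
support by \<open>h\<close> to the right.
\<close>

lemma summation_by_parts:
  fixes f :: "real \<Rightarrow> real" and z :: complex
  assumes "\<And>x. x < 0 \<Longrightarrow> f x = 0" "\<And>x. real n * h \<le> x \<Longrightarrow> f x = 0" "0 < h"
  shows "(1 - z) ^ q * (\<Sum>p<n. of_real (f (real p * h)) * z ^ p)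
    = (\<Sum>p<n + q. of_real ((backward_diff h ^^ q) f (real p * h)) * z ^ p)"
  using assms
proof (induction q arbitrary: f n)
  case (Suc q)
  let ?g = "backward_diff h f"
  have "(\<Sum>p<n + 1. of_real (?g (real p * h)) * z ^ p)
      = (\<Sum>p<n + 1. of_real (f (real p * h)) * z ^ p) - (\<Sum>p<n + 1. of_real (f (real p * h - h)) * z ^ p)"
    by (simp only: backward_diff_def of_real_diff left_diff_distrib sum_subtractf)
  also have "(\<Sum>p<n + 1. of_real (f (real p * h)) * z ^ p) = (\<Sum>p<n. of_real (f (real p * h)) * z ^ p)"
    using Suc.prems(2) by simp
  also have "(\<Sum>p<n + 1. of_real (f (real p * h - h)) * z ^ p) = (\<Sum>p<n. of_real (f (real (Suc p) * h - h)) * z ^ Suc p)"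
    using Suc.prems(1)[of "- h"] Suc.prems(3) by (simp only: Suc_eq_plus1[symmetric] sum.lessThan_Suc_shift) simp
  also have "\<dots> = z * (\<Sum>p<n. of_real (f (real p * h)) * z ^ p)"
    by (simp add: sum_distrib_left algebra_simps)
  finally have step: "(1 - z) * (\<Sum>p<n. of_real (f (real p * h)) * z ^ p)
      = (\<Sum>p<n + 1. of_real (?g (real p * h)) * z ^ p)"
    by (simp add: algebra_simps)
  have "(1 - z) ^ Suc q * (\<Sum>p<n. of_real (f (real p * h)) * z ^ p)
      = (1 - z) ^ q * (\<Sum>p<n + 1. of_real (?g (real p * h)) * z ^ p)"
    by (simp only: step[symmetric] power_Suc2 mult.assoc)
  also have "\<dots> = (\<Sum>p<n + 1 + q. of_real ((backward_diff h ^^ q) ?g (real p * h)) * z ^ p)"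
  proof (rule Suc.IH)
    show "?g x = 0" if "x < 0" for x
      using that Suc.prems(1)[of x] Suc.prems(1)[of "x - h"] Suc.prems(3) by (simp add: backward_diff_def)
    show "?g x = 0" if "real (n + 1) * h \<le> x" for x
    proof -
      have "real n * h \<le> x - h" "real n * h \<le> x" using that Suc.prems(3) by (auto simp: algebra_simps)
      then show ?thesis using Suc.prems(2) by (simp add: backward_diff_def)
    qed
  qed (use Suc.prems in auto)
  finally show ?case by (simp add: funpow_swap1)
qed simp

definition smooth :: "(real \<Rightarrow> real) \<Rightarrow> bool" where
  "smooth f \<longleftrightarrow> (\<forall>i. (deriv ^^ i) f differentiable_on UNIV)"

lemma smooth_DERIV:
  assumes "smooth f"
  shows "((deriv ^^ i) f has_real_derivative (deriv ^^ Suc i) f x) (at x)"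
proof -
  have "(deriv ^^ i) f differentiable (at x)"
    using assms by (simp add: smooth_def differentiable_on_def)
  then show ?thesis
    using DERIV_deriv_iff_real_differentiable by simp
qed

lemma DERIV_backward_diff:
  assumes "smooth f"
  shows "(backward_diff h ((deriv ^^ i) f) has_real_derivative backward_diff h ((deriv ^^ Suc i) f) x) (at x)"
proof -
  have "((\<lambda>x. (deriv ^^ i) f (x + - h)) has_real_derivative (deriv ^^ Suc i) f (x + - h)) (at x)"
    by (rule DERIV_shift[THEN iffD1, OF smooth_DERIV[OF assms]])
  from DERIV_diff[OF smooth_DERIV[OF assms, of i x] this]
  show ?thesis unfolding backward_diff_def[abs_def] by (simp only: add_uminus_conv_diff)
qed

lemma deriv_iter_backward_diff:
  assumes "smooth f"
  shows "(deriv ^^ i) (backward_diff h f) = backward_diff h ((deriv ^^ i) f)"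
proof (induction i)
  case (Suc i)
  have "deriv (backward_diff h ((deriv ^^ i) f)) = backward_diff h ((deriv ^^ Suc i) f)"
    by (rule ext) (rule DERIV_imp_deriv[OF DERIV_backward_diff[OF assms]])
  then show ?case using Suc by simp
qed simp

lemma smooth_backward_diff:
  assumes "smooth f"
  shows "smooth (backward_diff h f)"
proof -
  have "((deriv ^^ i) (backward_diff h f)) differentiable (at x)" for i x
    unfolding deriv_iter_backward_diff[OF assms] real_differentiable_def
    using DERIV_backward_diff[OF assms] by blast
  then show ?thesis by (auto simp: smooth_def differentiable_on_def differentiable_at_withinI)
qed

text \<open>
Differencing commutes with differentiation, so each difference costs one derivative by the mean
value theorem.
\<close>

lemma backward_diff_iter_bound:
  assumes "smooth f" "\<And>x. \<bar>(deriv ^^ q) f x\<bar> \<le> C" "0 < h"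
  shows "\<bar>(backward_diff h ^^ q) f x\<bar> \<le> C * h ^ q"
  using assms(1,2)
proof (induction q arbitrary: f C)
  case (Suc q)
  have "\<bar>(backward_diff h ^^ q) (backward_diff h f) x\<bar> \<le> (h * C) * h ^ q"
  proof (rule Suc.IH)
    show "smooth (backward_diff h f)" by (rule smooth_backward_diff[OF Suc.prems(1)])
    fix y
    obtain w where "(deriv ^^ q) f y - (deriv ^^ q) f (y - h) = (y - (y - h)) * (deriv ^^ Suc q) f w"
      using MVT2[of "y - h" y "(deriv ^^ q) f" "(deriv ^^ Suc q) f"] smooth_DERIV[OF Suc.prems(1)] assms(3)
      by (metis diff_less_eq less_add_same_cancel1)
    then have "\<bar>(deriv ^^ q) (backward_diff h f) y\<bar> = h * \<bar>(deriv ^^ Suc q) f w\<bar>"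
      using assms(3) unfolding deriv_iter_backward_diff[OF Suc.prems(1)] backward_diff_def
      by (simp add: abs_mult)
    also have "\<dots> \<le> h * C" using Suc.prems(2) assms(3) by (intro mult_left_mono) auto
    finally show "\<bar>(deriv ^^ q) (backward_diff h f) y\<bar> \<le> h * C" .
  qed
  then show ?case by (simp add: funpow_swap1 mult_ac)
qed simp

lemma cutoff_smooth: "cutoff \<chi> \<Longrightarrow> smooth \<chi>"
  by (simp add: cutoff_def smooth_def)

lemma cutoff_range: "cutoff \<chi> \<Longrightarrow> 0 \<le> \<chi> x \<and> \<chi> x \<le> 1"
  by (force simp: cutoff_def)

text \<open>
All derivatives vanish off the support and are continuous on \<open>[0, 1]\<close>.
\<close>

lemma cutoff_deriv_bounded:
  assumes "cutoff \<chi>"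
  obtains C where "0 \<le> C" "\<And>x. \<bar>(deriv ^^ q) \<chi> x\<bar> \<le> C"
proof -
  define S where "S = - closure {x. \<chi> x \<noteq> 0}"
  have S: "open S" by (simp add: S_def open_Compl)
  have zero: "(deriv ^^ i) \<chi> x = 0" if "x \<in> S" for i x
    using that
  proof (induction i arbitrary: x)
    case 0
    then have "x \<notin> {x. \<chi> x \<noteq> 0}" using closure_subset[of "{x. \<chi> x \<noteq> 0}"] by (auto simp: S_def)
    then show ?case by simp
  next
    case (Suc i)
    have "((deriv ^^ i) \<chi> has_real_derivative 0) (at x)"
      by (rule DERIV_cong_ev[THEN iffD2, OF refl _ refl DERIV_const[of 0]])
        (use Suc S in \<open>auto simp: eventually_nhds\<close>)
    then show ?case by (simp add: DERIV_imp_deriv)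
  qed
  have "continuous_on {0..1} ((deriv ^^ q) \<chi>)"
    using DERIV_isCont[OF smooth_DERIV[OF cutoff_smooth[OF assms]]] by (auto intro: continuous_at_imp_continuous_on)
  then have "bounded ((deriv ^^ q) \<chi> ` {0..1})"
    by (intro compact_imp_bounded compact_continuous_image) auto
  then obtain B where "\<forall>x\<in>{0..1}. \<bar>(deriv ^^ q) \<chi> x\<bar> \<le> B"
    by (auto simp: bounded_iff)
  then have B: "\<bar>(deriv ^^ q) \<chi> x\<bar> \<le> B" if "x \<in> {0..1}" for x using that by blast
  have "\<bar>(deriv ^^ q) \<chi> x\<bar> \<le> \<bar>B\<bar>" for x
  proof (cases "x \<in> S")
    case False
    then have "x \<in> {0<..<1}" using assms by (auto simp: S_def cutoff_def)
    then show ?thesis using B[of x] by simp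
  qed (simp add: zero)
  then show thesis by (intro that[of "\<bar>B\<bar>"]) auto
qed

lemma cutoff_support:
  assumes "cutoff \<chi>"
  obtains c where "0 < c" "c < 1" "\<And>x. \<chi> x \<noteq> 0 \<Longrightarrow> c \<le> x \<and> x \<le> 1 - c"
proof -
  let ?K = "closure {x. \<chi> x \<noteq> 0}"
  have sub: "?K \<subseteq> {0<..<1}" using assms by (simp add: cutoff_def)
  then have "bounded ?K" by (rule bounded_subset[rotated]) simp
  then have "compact ?K" by (simp add: compact_eq_bounded_closed)
  moreover have "?K \<inter> - {0<..<1} = {}" using sub by auto
  ultimately obtain d where d: "0 < d" "\<forall>x\<in>?K. \<forall>y\<in>- {0<..<1}. d \<le> dist x y"
    using separate_compact_closed[of ?K "- {0<..<1}"] by (auto simp: closed_Compl)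
  have "d \<le> x \<and> x \<le> 1 - d" if "\<chi> x \<noteq> 0" for x
  proof -
    have x: "x \<in> ?K" using that closure_subset[of "{x. \<chi> x \<noteq> 0}"] by auto
    have "d \<le> dist x 0" "d \<le> dist x 1" by (rule d(2)[rule_format, OF x], simp)+
    then show ?thesis using x sub by (auto simp: dist_real_def)
  qed
  then show thesis using d(1) by (intro that[of "min d (1 / 2)"]) fastforce+
qed

lemma norm_1_minus_cis: "cmod (1 - cis (2 * x)) = 2 * \<bar>sin x\<bar>"
proof -
  have "1 - cis (2 * x) = - (2 * \<i> * of_real (sin x)) * cis x"
    by (simp add: complex_eq_iff cos_double_sin sin_double power2_eq_square)
  then show ?thesis by (simp add: norm_mult)
qed

text \<open>
The function \<open>sin (pi t)\<close> is concave on \<open>[0, 1]\<close>, so it lies above its chord over \<open>[0, b]\<close>.  The constant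
degenerates as \<open>b\<close> tends to 1, where \<open>2 pi t\<close> comes back to a multiple of the full period.
\<close>

lemma norm_1_minus_cis_ge:
  assumes b: "0 < b" "b < 1" and t: "\<bar>t\<bar> \<le> b"
  shows "2 * sin (pi * b) / b * \<bar>t\<bar> \<le> cmod (1 - cis (2 * pi * t))"
proof -
  have "concave_on {0..1} (\<lambda>t. sin (pi * t))"
  proof (rule f''_le0_imp_concave)
    show "DERIV (\<lambda>t. sin (pi * t)) x :> pi * cos (pi * x)" for x
      by (auto intro!: derivative_eq_intros)
    show "DERIV (\<lambda>t. pi * cos (pi * t)) x :> - (pi * pi * sin (pi * x))" for x
      by (auto intro!: derivative_eq_intros)
    show "- (pi * pi * sin (pi * x)) \<le> 0" if "x \<in> {0..1}" for x
      using that by (auto intro!: mult_nonneg_nonneg sin_ge_zero)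
  qed auto
  from concave_onD[OF this, of "\<bar>t\<bar> / b" 0 b]
  have "\<bar>t\<bar> / b * sin (pi * b) \<le> sin (pi * \<bar>t\<bar>)"
    using b t by simp
  also have "\<dots> \<le> \<bar>sin (pi * t)\<bar>" by (cases "0 \<le> t") auto
  finally have "2 * (\<bar>t\<bar> / b * sin (pi * b)) \<le> cmod (1 - cis (2 * (pi * t)))"
    unfolding norm_1_minus_cis by (intro mult_left_mono) auto
  then show ?thesis by (simp add: mult_ac)
qed

section \<open>The kernel of the open quantum baker's map\<close>

text \<open>
The operator \<open>\<Sum>\<^sub>a \<Pi>\<^sub>a* \<chi> F \<chi> \<Pi>\<^sub>a\<close> on \<open>M n\<close> points: position \<open>l\<close> lies in block \<open>l div n\<close> at offset \<open>l mod n\<close>.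
\<close>

definition block_kernel :: "nat set \<Rightarrow> (real \<Rightarrow> real) \<Rightarrow> nat \<Rightarrow> nat \<Rightarrow> nat \<Rightarrow> complex" where
  "block_kernel A \<chi> n j l = (if j div n = l div n \<and> l div n \<in> A
    then of_real (\<chi> (real (j mod n) / real n)) * fourier_kernel n (j mod n) (l mod n)
      * of_real (\<chi> (real (l mod n) / real n)) else 0)"

text \<open>
The open baker's map as \<open>F* D\<close>, with \<open>D\<close> the block-diagonal operator and \<open>N = M n\<close>.
\<close>

definition baker_kernel :: "nat \<Rightarrow> nat set \<Rightarrow> (real \<Rightarrow> real) \<Rightarrow> nat \<Rightarrow> nat \<Rightarrow> nat \<Rightarrow> complex" where
  "baker_kernel M A \<chi> n j l =
    (\<Sum>p<M * n. cnj (fourier_kernel (M * n) j p) * block_kernel A \<chi> n p l)"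

lemma block_kernel_sym: "block_kernel A \<chi> n j l = block_kernel A \<chi> n l j"
  by (auto simp: block_kernel_def fourier_kernel_sym mult_ac)

lemma sum_over_block:
  fixes f :: "nat \<Rightarrow> complex"
  assumes "a < M" "\<And>p. p div n \<noteq> a \<Longrightarrow> f p = 0"
  shows "(\<Sum>p<M * n. f p) = (\<Sum>p<n. f (a * n + p))"
proof -
  have "(\<Sum>p<M * n. f p) = (\<Sum>b<M. \<Sum>p = b * n..<b * n + n. f p)"
    by (simp add: sum.nat_group)
  also have "\<dots> = (\<Sum>b<M. if b = a then (\<Sum>p = a * n..<a * n + n. f p) else 0)"
  proof (intro sum.cong refl)
    fix b
    have "f p = 0" if "b \<noteq> a" "p \<in> {b * n..<b * n + n}" for p
    proof (rule assms(2))
      have "p div n = b" using that by (intro div_nat_eqI) (auto simp: mult.commute)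
      then show "p div n \<noteq> a" using that by simp
    qed
    then show "(\<Sum>p = b * n..<b * n + n. f p) = (if b = a then (\<Sum>p = a * n..<a * n + n. f p) else 0)"
      by (auto intro!: sum.neutral)
  qed
  also have "\<dots> = (\<Sum>p = a * n..<a * n + n. f p)" using assms(1) by simp
  also have "\<dots> = (\<Sum>p<n. f (a * n + p))"
    using sum.shift_bounds_nat_ivl[of f 0 "a * n" n] by (simp add: atLeast0LessThan add.commute)
  finally show ?thesis .
qed

text \<open>
Only the block that contains \<open>l\<close> contributes, and the two Fourier phases combine into powers of
\<open>cis (2 pi (j - M (l mod n)) / N)\<close>.  The frequency measures the distance from \<open>j\<close> to the image of \<open>l\<close>
under the classical expanding map.
\<close>

lemma baker_kernel_eq:
  assumes "0 < n" "l div n \<in> A" "l div n < M"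
  shows "baker_kernel M A \<chi> n j l = cis (2 * pi * real j * real (l div n) / real M)
    * of_real (\<chi> (real (l mod n) / real n)) / of_real (sqrt (real (M * n)) * sqrt (real n))
    * (\<Sum>p<n. of_real (\<chi> (real p * (1 / real n)))
         * cis (2 * pi * ((real j - real M * real (l mod n)) / real (M * n))) ^ p)"
proof -
  define a where "a = l div n"
  have "baker_kernel M A \<chi> n j l
      = (\<Sum>p<n. cnj (fourier_kernel (M * n) j (a * n + p)) * block_kernel A \<chi> n (a * n + p) l)"
    unfolding baker_kernel_def
    by (rule sum_over_block) (use assms in \<open>auto simp: block_kernel_def a_def\<close>)
  also have "\<dots> = (\<Sum>p<n. cis (2 * pi * real j * real a / real M)
    * of_real (\<chi> (real (l mod n) / real n)) / of_real (sqrt (real (M * n)) * sqrt (real n))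
    * (of_real (\<chi> (real p * (1 / real n)))
         * cis (2 * pi * ((real j - real M * real (l mod n)) / real (M * n))) ^ p))"
  proof (intro sum.cong refl)
    fix p assume "p \<in> {..<n}"
    then have p: "p < n" by simp
    have dm: "(a * n + p) div n = a" "(a * n + p) mod n = p" using p by auto
    have block: "block_kernel A \<chi> n (a * n + p) l = of_real (\<chi> (real p * (1 / real n)))
        * (cis (- 2 * pi * real p * real (l mod n) / real n) / of_real (sqrt (real n)))
        * of_real (\<chi> (real (l mod n) / real n))"
      using assms(2) unfolding block_kernel_def dm fourier_kernel_def a_def[symmetric] by simp
    have swap: "e1 / s1 * (x * (e2 / s2) * y) = e1 * e2 * y / (s1 * s2) * x" for e1 e2 s1 s2 x y :: complex
      by simp
    have "cis (2 * pi * real j * real (a * n + p) / real (M * n)) * cis (- 2 * pi * real p * real (l mod n) / real n)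
        = cis (2 * pi * real j * real a / real M) * cis (2 * pi * ((real j - real M * real (l mod n)) / real (M * n))) ^ p"
      unfolding Complex.DeMoivre cis_mult using assms
      by (intro arg_cong[where f = cis]) (simp add: field_simps)
    then show "cnj (fourier_kernel (M * n) j (a * n + p)) * block_kernel A \<chi> n (a * n + p) l
      = cis (2 * pi * real j * real a / real M)
      * of_real (\<chi> (real (l mod n) / real n)) / of_real (sqrt (real (M * n)) * sqrt (real n))
      * (of_real (\<chi> (real p * (1 / real n)))
         * cis (2 * pi * ((real j - real M * real (l mod n)) / real (M * n))) ^ p)"
      unfolding cnj_fourier_kernel block swap of_real_mult by (simp only:) (simp only: mult_ac times_divide_eq_left times_divide_eq_right)
  qed
  finally show ?thesis by (simp only: a_def sum_distrib_left)
qed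

text \<open>
Rapid decay away from the graph of the expanding map: \<open>q\<close> summations by parts gain the factor
\<open>(n |1 - z|)^(-q)\<close>.  The frequency is only defined modulo \<open>N\<close>, so \<open>1 - z\<close> could be small far from the
graph when \<open>j\<close> and \<open>M (l mod n)\<close> sit at opposite ends of \<open>{0..<N}\<close>.  The factor \<open>\<chi>\<close> at \<open>l mod n\<close>
excludes this, since it vanishes unless \<open>M (l mod n)\<close> is at distance at least \<open>c N\<close> from both ends.
The constant does not depend on \<open>n\<close>.
\<close>

lemma baker_kernel_decay:
  assumes \<chi>: "cutoff \<chi>" and M: "0 < M"
  obtains C where "0 \<le> C"
    "\<And>n j l d. \<lbrakk>0 < n; j < M * n; l < M * n; l div n \<in> A; 0 < d; d \<le> \<bar>real j - real M * real (l mod n)\<bar>\<rbrakk>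
      \<Longrightarrow> cmod (baker_kernel M A \<chi> n j l) \<le> C / d ^ q"
proof -
  obtain C where C: "0 \<le> C" "\<And>x. \<bar>(deriv ^^ q) \<chi> x\<bar> \<le> C"
    using cutoff_deriv_bounded[OF \<chi>] by metis
  obtain c where c: "0 < c" "c < 1" "\<And>x. \<chi> x \<noteq> 0 \<Longrightarrow> c \<le> x \<and> x \<le> 1 - c"
    using cutoff_support[OF \<chi>] by metis
  define b where "b = 1 - c"
  have b: "0 < b" "b < 1" using c by (auto simp: b_def)
  define \<kappa> where "\<kappa> = 2 * sin (pi * b) / b"
  have \<kappa>: "0 < \<kappa>" using b by (auto simp: \<kappa>_def intro!: divide_pos_pos mult_pos_pos sin_gt_zero)
  define C' where "C' = real (1 + q) * C * (real M / \<kappa>) ^ q"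
  have C': "0 \<le> C'" using C(1) \<kappa> by (simp add: C'_def)
  show thesis
  proof (rule that[OF C'])
    fix n j l :: nat and d :: real
    assume n: "0 < n" and j: "j < M * n" and l: "l < M * n" and lA: "l div n \<in> A"
      and d: "0 < d" "d \<le> \<bar>real j - real M * real (l mod n)\<bar>"
    \<comment> \<open>The rescaled offset, and the frequency as a fraction of the full period.\<close>
    define x where "x = real (l mod n) / real n"
    define t where "t = (real j - real M * real (l mod n)) / real (M * n)"
    define z where "z = cis (2 * pi * t)"
    define S where "S = (\<Sum>p<n. of_real (\<chi> (real p * (1 / real n))) * z ^ p)"
    have lM: "l div n < M" using l n by (simp add: less_mult_imp_div_less)
    have MN: "0 < real (M * n)" using M n by simp
    have eq: "cmod (baker_kernel M A \<chi> n j l) = \<bar>\<chi> x\<bar> / (sqrt (real (M * n)) * sqrt (real n)) * cmod S"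
      unfolding baker_kernel_eq[OF n lA lM] S_def[symmetric] z_def[symmetric] t_def[symmetric] x_def[symmetric]
      by (simp add: norm_mult norm_divide)
    show "cmod (baker_kernel M A \<chi> n j l) \<le> C' / d ^ q"
    proof (cases "\<chi> x = 0")
      case True
      then show ?thesis using C' d by (simp add: eq)
    next
      case False
      have tx: "t = real j / real (M * n) - x" using M n by (simp add: t_def x_def field_simps)
      moreover have "0 \<le> real j / real (M * n)" "real j / real (M * n) < 1"
        using j MN by (auto simp del: of_nat_mult)
      ultimately have "\<bar>t\<bar> \<le> b" using c(3)[OF False] unfolding b_def by linarith
      then have "\<kappa> * \<bar>t\<bar> \<le> cmod (1 - z)"
        unfolding \<kappa>_def z_def by (rule norm_1_minus_cis_ge[OF b])
      moreover have "d / real (M * n) \<le> \<bar>t\<bar>"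
        using d MN unfolding t_def abs_divide by (simp add: divide_right_mono)
      ultimately have low: "\<kappa> * d / real (M * n) \<le> cmod (1 - z)"
        using \<kappa> mult_left_mono[of "d / real (M * n)" "\<bar>t\<bar>" \<kappa>] by simp
      have low0: "0 < \<kappa> * d / real (M * n)" using \<kappa> d MN by simp
      have supp: "\<chi> y = 0" if "y < 0 \<or> 1 \<le> y" for y using c(1) c(3)[of y] that by force
      have "(1 - z) ^ q * S = (\<Sum>p<n + q. of_real ((backward_diff (1 / real n) ^^ q) \<chi> (real p * (1 / real n))) * z ^ p)"
        unfolding S_def by (rule summation_by_parts) (use supp n in auto)
      also have "cmod \<dots> \<le> (\<Sum>p<n + q. C * (1 / real n) ^ q)"
      proof (rule sum_norm_le)
        fix p
        have "cmod (of_real ((backward_diff (1 / real n) ^^ q) \<chi> (real p * (1 / real n))) * z ^ p)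
            = \<bar>(backward_diff (1 / real n) ^^ q) \<chi> (real p * (1 / real n))\<bar>"
          by (simp add: norm_mult norm_power z_def)
        also have "\<dots> \<le> C * (1 / real n) ^ q"
          using n by (intro backward_diff_iter_bound cutoff_smooth \<chi> C) auto
        finally show "cmod (of_real ((backward_diff (1 / real n) ^^ q) \<chi> (real p * (1 / real n))) * z ^ p)
          \<le> C * (1 / real n) ^ q" .
      qed
      finally have "cmod (1 - z) ^ q * cmod S \<le> real (n + q) * (C * (1 / real n) ^ q)"
        by (simp add: norm_mult norm_power)
      moreover have "(\<kappa> * d / real (M * n)) ^ q * cmod S \<le> cmod (1 - z) ^ q * cmod S"
        using low low0 by (intro mult_right_mono power_mono) auto
      ultimately have "cmod S \<le> real (n + q) * (C * (1 / real n) ^ q) / (\<kappa> * d / real (M * n)) ^ q"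
        using low0 by (simp add: pos_le_divide_eq mult.commute del: of_nat_mult of_nat_add)
      also have "\<dots> = real (n + q) * C * (real M / \<kappa>) ^ q / d ^ q"
        using n M \<kappa> d by (simp add: power_divide power_mult_distrib field_simps)
      also have "\<dots> \<le> (real n * real (1 + q)) * C * (real M / \<kappa>) ^ q / d ^ q"
      proof -
        have "n + q \<le> n * (1 + q)" using n by (cases n) auto
        then have "real (n + q) \<le> real n * real (1 + q)" by (metis of_nat_le_iff of_nat_mult)
        then show ?thesis using C(1) \<kappa> d by (intro divide_right_mono mult_right_mono) auto
      qed
      finally have S: "cmod S \<le> real n * (C' / d ^ q)" by (simp add: C'_def mult.assoc)
      have "real n = sqrt (real n) * sqrt (real n)" by simp
      also have "\<dots> \<le> sqrt (real (M * n)) * sqrt (real n)"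
        using M by (intro mult_right_mono real_sqrt_le_mono of_nat_mono) auto
      finally have nle: "real n \<le> sqrt (real (M * n)) * sqrt (real n)" .
      have "cmod (baker_kernel M A \<chi> n j l) \<le> 1 / real n * (real n * (C' / d ^ q))"
        unfolding eq using nle S cutoff_range[OF \<chi>, of x] n C'
        by (intro mult_mono frac_le) auto
      then show ?thesis using n by simp
    qed
  qed
qed

lemma lessThan_mult_eq_image:
  fixes n :: nat
  shows "{..<M * n} = (\<lambda>(c, d). c + n * d) ` ({..<n} \<times> {..<M})"
proof (intro equalityI subsetI)
  fix x assume "x \<in> {..<M * n}"
  then have "x < M * n" by simp
  then have "0 < n" "x div n < M" by (auto simp: less_mult_imp_div_less intro: gr0I)
  then have "x = (\<lambda>(c, d). c + n * d) (x mod n, x div n)" "(x mod n, x div n) \<in> {..<n} \<times> {..<M}" by auto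
  then show "x \<in> (\<lambda>(c, d). c + n * d) ` ({..<n} \<times> {..<M})" by (rule image_eqI)
next
  fix x assume "x \<in> (\<lambda>(c, d). c + n * d) ` ({..<n} \<times> {..<M})"
  then obtain c d where x: "x = c + n * d" "c < n" "d < M" by auto
  then have "x < n * Suc d" by simp
  also have "\<dots> \<le> n * M" using x by (intro mult_left_mono) auto
  finally show "x \<in> {..<M * n}" by (simp add: mult.commute)
qed

text \<open>
Up to reindexing by offset and block, the tensor product of \<open>\<chi> F \<chi>\<close> with the projection to the blocks
in \<open>A\<close>.
\<close>

lemma block_kernel_bound:
  assumes \<chi>: "cutoff \<chi>" and n: "0 < n"
  shows "kernel_bound {..<M * n} {..<M * n} (block_kernel A \<chi> n) 1"
proof -
  let ?f = "\<lambda>(c, d). c + n * d"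
  define K1 where "K1 j l = complex_of_real (\<chi> (real j / real n)) * fourier_kernel n j l
    * complex_of_real (\<chi> (real l / real n))" for j l
  have inj: "inj_on ?f ({..<n} \<times> {..<M})" by (rule inj_on_digits) simp
  have norm_\<chi>: "cmod (complex_of_real (\<chi> x)) \<le> 1" for x using cutoff_range[OF \<chi>, of x] by simp
  have K1: "kernel_bound {..<n} {..<n} K1 1"
    unfolding K1_def by (rule kernel_bound_weights[OF fourier_bound _ _ _ norm_\<chi> norm_\<chi>]) auto
  have K2: "kernel_bound {..<M} {..<M} (\<lambda>a b. if a = b then if a \<in> A then 1 else 0 else 0) 1"
    by (rule kernel_bound_diag) auto
  have "kernel_bound ({..<n} \<times> {..<M}) ({..<n} \<times> {..<M})
      (\<lambda>(j, a) (l, b). K1 j l * (if a = b then if a \<in> A then 1 else 0 else 0) * 1) (1 * 1)"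
    by (rule kernel_bound_tensor[OF _ _ _ _ K1 _ K2]) auto
  then have "kernel_bound (?f ` ({..<n} \<times> {..<M})) (?f ` ({..<n} \<times> {..<M})) (block_kernel A \<chi> n) 1"
    unfolding kernel_bound_reindex[OF inj inj]
    by (subst (asm) kernel_bound_cong[where K' = "\<lambda>p q. block_kernel A \<chi> n (?f p) (?f q)"])
      (use n in \<open>auto simp: block_kernel_def K1_def\<close>)
  then show ?thesis by (simp only: lessThan_mult_eq_image)
qed

lemma baker_kernel_bound:
  assumes "cutoff \<chi>" "0 < n"
  shows "kernel_bound {..<M * n} {..<M * n} (baker_kernel M A \<chi> n) 1"
  using kernel_bound_comp[OF kernel_bound_cnj[OF fourier_bound] block_kernel_bound[OF assms]]
  by (simp add: baker_kernel_def[abs_def])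

lemma mult_mat_index:
  fixes A B :: "complex mat"
  assumes "A \<in> carrier_mat n m" "B \<in> carrier_mat m k" "i < n" "j < k"
  shows "(A * B) $$ (i, j) = (\<Sum>p<m. A $$ (i, p) * B $$ (p, j))"
  using assms by (auto simp: scalar_prod_def atLeast0LessThan intro!: sum.cong)

lemma mat_adjoint_index:
  fixes A :: "complex mat"
  assumes "A \<in> carrier_mat n m" "i < m" "j < n"
  shows "mat_adjoint A $$ (i, j) = cnj (A $$ (j, i))"
  using assms by (simp add: mat_adjoint_def mat_of_rows_def)

lemma mat_adjoint_carrier: "A \<in> carrier_mat n m \<Longrightarrow> mat_adjoint A \<in> carrier_mat m n"
  by (simp add: mat_adjoint_def mat_of_rows_def)

text \<open>
The bridge from the product of matrices that defines the open baker's map to its kernel, obtained by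
multiplying out the factors from left to right.
\<close>

lemma baker_map_index:
  assumes A: "A \<subseteq> {0..<M}" and n: "0 < n" and i: "i < M * n" and l: "l < M * n"
  shows "baker_map M A \<chi> (M * n) $$ (i, l) = baker_kernel M A \<chi> n i l"
proof -
  let ?N = "M * n"
  have M: "0 < M" using i by (cases M) auto
  have lM: "l div n < M" using l n by (simp add: less_mult_imp_div_less)
  define F Fn C where "F = fourier_mat ?N" and "Fn = fourier_mat n" and "C = cutoff_mat \<chi> n"
  define P where "P a = proj_mat M ?N a" for a
  have F: "F \<in> carrier_mat ?N ?N" and Fn: "Fn \<in> carrier_mat n n" and C: "C \<in> carrier_mat n n"
    by (auto simp: F_def Fn_def C_def fourier_mat_def cutoff_mat_def mat_diag_def)
  have P: "P a \<in> carrier_mat n ?N" for a using M by (simp add: P_def proj_mat_def)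
  have Fij: "F $$ (r, i) = fourier_kernel ?N i r" if "r < ?N" for r
    using that i by (simp add: F_def fourier_mat_index fourier_kernel_sym[of _ r])
  have Pij: "P a $$ (p, l) = (if l = p + a * n then 1 else 0)" if "p < n" "l < ?N" for a p l
    using that M by (simp add: P_def proj_mat_def)
  have Cij: "C $$ (p, r) = (if p = r then of_real (\<chi> (real r / real n)) else 0)" if "p < n" "r < n" for p r
    using that by (auto simp: C_def cutoff_mat_def mat_diag_def)
  have summand: "(mat_adjoint F * mat_adjoint (P a) * C * Fn * C * P a) $$ (i, l)
      = (if l div n = a then \<Sum>p<n. cnj (fourier_kernel ?N i (a * n + p)) * block_kernel A \<chi> n (a * n + p) l else 0)"
    if a: "a \<in> A" for a
  proof -
    have aM: "a < M" using a A by auto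
    have bound: "p + a * n < ?N" if "p < n" for p
    proof -
      have "p + a * n < Suc a * n" using that by simp
      also have "\<dots> \<le> ?N" using aM by (intro mult_right_mono) auto
      finally show ?thesis .
    qed
    note adj = mat_adjoint_carrier[OF F] mat_adjoint_carrier[OF P[of a]]
    have Q1: "(mat_adjoint F * mat_adjoint (P a)) $$ (i, p) = cnj (fourier_kernel ?N i (p + a * n))" if p: "p < n" for p
    proof -
      have "(mat_adjoint F * mat_adjoint (P a)) $$ (i, p)
          = (\<Sum>r<?N. mat_adjoint F $$ (i, r) * mat_adjoint (P a) $$ (r, p))"
        by (rule mult_mat_index[OF adj i p])
      also have "\<dots> = (\<Sum>r<?N. if r = p + a * n then cnj (fourier_kernel ?N i r) else 0)"
        using i p by (intro sum.cong refl)
          (simp add: mat_adjoint_index[OF F] mat_adjoint_index[OF P] Pij Fij)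
      finally show ?thesis using bound[OF p] by simp
    qed
    have Q2: "(mat_adjoint F * mat_adjoint (P a) * C) $$ (i, p)
        = cnj (fourier_kernel ?N i (p + a * n)) * of_real (\<chi> (real p / real n))" if p: "p < n" for p
    proof -
      have "(mat_adjoint F * mat_adjoint (P a) * C) $$ (i, p)
          = (\<Sum>r<n. (mat_adjoint F * mat_adjoint (P a)) $$ (i, r) * C $$ (r, p))"
        by (rule mult_mat_index[OF mult_carrier_mat[OF adj] C i p])
      also have "\<dots> = (\<Sum>r<n. if r = p then (mat_adjoint F * mat_adjoint (P a)) $$ (i, r) * of_real (\<chi> (real r / real n)) else 0)"
        using p by (intro sum.cong) (auto simp: Cij)
      finally show ?thesis using p by (simp add: Q1)
    qed
    have Q3: "(mat_adjoint F * mat_adjoint (P a) * C * Fn) $$ (i, r)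
        = (\<Sum>p<n. cnj (fourier_kernel ?N i (p + a * n)) * of_real (\<chi> (real p / real n)) * fourier_kernel n p r)"
      if r: "r < n" for r
      unfolding mult_mat_index[OF mult_carrier_mat[OF mult_carrier_mat[OF adj] C] Fn i r]
      using r by (intro sum.cong) (auto simp: Q2 Fn_def fourier_mat_index)
    have c4: "mat_adjoint F * mat_adjoint (P a) * C * Fn \<in> carrier_mat ?N n"
      by (rule mult_carrier_mat[OF mult_carrier_mat[OF mult_carrier_mat[OF adj] C] Fn])
    have Q4: "(mat_adjoint F * mat_adjoint (P a) * C * Fn * C) $$ (i, r)
        = (\<Sum>p<n. cnj (fourier_kernel ?N i (p + a * n)) * of_real (\<chi> (real p / real n)) * fourier_kernel n p r)
          * of_real (\<chi> (real r / real n))" if r: "r < n" for r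
    proof -
      have "(mat_adjoint F * mat_adjoint (P a) * C * Fn * C) $$ (i, r)
          = (\<Sum>p<n. (mat_adjoint F * mat_adjoint (P a) * C * Fn) $$ (i, p) * C $$ (p, r))"
        by (rule mult_mat_index[OF c4 C i r])
      also have "\<dots> = (\<Sum>p<n. if p = r then (mat_adjoint F * mat_adjoint (P a) * C * Fn) $$ (i, p) * of_real (\<chi> (real p / real n)) else 0)"
        using r by (intro sum.cong) (auto simp: Cij)
      finally show ?thesis using r by (simp add: Q3)
    qed
    have "(mat_adjoint F * mat_adjoint (P a) * C * Fn * C * P a) $$ (i, l)
        = (\<Sum>r<n. (mat_adjoint F * mat_adjoint (P a) * C * Fn * C) $$ (i, r) * P a $$ (r, l))"
      by (rule mult_mat_index[OF mult_carrier_mat[OF c4 C] P i l])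
    also have "\<dots> = (\<Sum>r<n. if r = l mod n then (if l div n = a then (mat_adjoint F * mat_adjoint (P a) * C * Fn * C) $$ (i, r) else 0) else 0)"
    proof (intro sum.cong refl)
      fix r assume "r \<in> {..<n}"
      then have r: "r < n" by simp
      have "l = r + a * n \<longleftrightarrow> r = l mod n \<and> l div n = a"
      proof
        assume "l = r + a * n"
        then show "r = l mod n \<and> l div n = a" using r by simp
      next
        assume "r = l mod n \<and> l div n = a"
        then show "l = r + a * n" by (metis mod_div_mult_eq)
      qed
      then show "(mat_adjoint F * mat_adjoint (P a) * C * Fn * C) $$ (i, r) * P a $$ (r, l)
        = (if r = l mod n then (if l div n = a then (mat_adjoint F * mat_adjoint (P a) * C * Fn * C) $$ (i, r) else 0) else 0)"
        using Pij[OF r l] by simp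
    qed
    also have "\<dots> = (if l div n = a then (mat_adjoint F * mat_adjoint (P a) * C * Fn * C) $$ (i, l mod n) else 0)"
      using n by simp
    also have "\<dots> = (if l div n = a then \<Sum>p<n. cnj (fourier_kernel ?N i (a * n + p)) * block_kernel A \<chi> n (a * n + p) l else 0)"
    proof (cases "l div n = a")
      case True
      have "(mat_adjoint F * mat_adjoint (P a) * C * Fn * C) $$ (i, l mod n)
          = (\<Sum>p<n. cnj (fourier_kernel ?N i (a * n + p)) * block_kernel A \<chi> n (a * n + p) l)"
        using n a by (subst Q4, simp, subst sum_distrib_right)
          (intro sum.cong refl, auto simp: block_kernel_def True add.commute mult.assoc)
      then show ?thesis using True by simp
    qed simp
    finally show ?thesis .
  qed
  have finA: "finite A" using A finite_subset by auto
  have "baker_map M A \<chi> ?N $$ (i, l) = (\<Sum>a\<in>A. (mat_adjoint F * mat_adjoint (P a) * C * Fn * C * P a) $$ (i, l))"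
    using i l M unfolding baker_map_entries[OF finA] by (simp add: F_def P_def C_def Fn_def)
  also have "\<dots> = (\<Sum>a\<in>A. if l div n = a then \<Sum>p<n. cnj (fourier_kernel ?N i (a * n + p)) * block_kernel A \<chi> n (a * n + p) l else 0)"
    using summand by (rule sum.cong[OF refl])
  also have "\<dots> = baker_kernel M A \<chi> n i l"
  proof (cases "l div n \<in> A")
    case True
    have "baker_kernel M A \<chi> n i l = (\<Sum>p<n. cnj (fourier_kernel ?N i (l div n * n + p)) * block_kernel A \<chi> n (l div n * n + p) l)"
      unfolding baker_kernel_def by (rule sum_over_block) (use lM in \<open>auto simp: block_kernel_def\<close>)
    then show ?thesis using True finA by simp
  next
    case False
    then show ?thesis by (auto simp: baker_kernel_def block_kernel_def intro!: sum.neutral)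
  qed
  finally show ?thesis .
qed

lemma baker_map_carrier: "finite A \<Longrightarrow> baker_map M A \<chi> N \<in> carrier_mat N N"
  by (simp add: baker_map_entries)

section \<open>Localisation of powers and of eigenfunctions\<close>

fun kernel_power :: "'a set \<Rightarrow> ('a \<Rightarrow> 'a \<Rightarrow> complex) \<Rightarrow> nat \<Rightarrow> 'a \<Rightarrow> 'a \<Rightarrow> complex" where
  "kernel_power V G 0 j l = (if j = l then 1 else 0)"
| "kernel_power V G (Suc i) j l = (\<Sum>p\<in>V. kernel_power V G i j p * G p l)"

lemma kernel_power_bound:
  assumes "finite V" "kernel_bound V V G 1"
  shows "kernel_bound V V (kernel_power V G i) 1"
proof (induction i)
  case 0
  have "kernel_power V G 0 = (\<lambda>j l. if j = l then 1 else 0)" by (intro ext) simp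
  then show ?case using kernel_bound_diag[OF assms(1), of "\<lambda>_. 1"] by simp
next
  case (Suc i)
  have "kernel_power V G (Suc i) = (\<lambda>j l. \<Sum>p\<in>V. kernel_power V G i j p * G p l)"
    by (intro ext) simp
  then show ?case using kernel_bound_comp[OF Suc assms(2)] by simp
qed

lemma kernel_power_eigen:
  assumes "finite V" "\<And>j. j \<in> V \<Longrightarrow> kernel_apply G V u j = ev * u j" "j \<in> V"
  shows "kernel_apply (kernel_power V G i) V u j = ev ^ i * u j"
  using assms(3)
proof (induction i arbitrary: j)
  case 0
  then show ?case using assms(1) by (simp add: kernel_apply_def if_distrib[of "\<lambda>x. x * _"] cong: if_cong)
next
  case (Suc i)
  have "kernel_apply (kernel_power V G (Suc i)) V u j = (\<Sum>p\<in>V. kernel_power V G i j p * kernel_apply G V u p)"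
    unfolding kernel_apply_def
    by (simp add: sum_distrib_right sum_distrib_left mult.assoc) (rule sum.swap)
  also have "\<dots> = ev * kernel_apply (kernel_power V G i) V u j"
    using assms(2) by (simp add: kernel_apply_def sum_distrib_left mult_ac)
  finally show ?case by (simp only: Suc.IH[OF Suc.prems] power_Suc mult.assoc)
qed

lemma kernel_power_transpose_eigen:
  assumes "finite V" "\<And>l. l \<in> V \<Longrightarrow> kernel_apply (\<lambda>l j. G j l) V v l = ev * v l" "l \<in> V"
  shows "kernel_apply (\<lambda>l j. kernel_power V G i j l) V v l = ev ^ i * v l"
  using assms(3)
proof (induction i arbitrary: l)
  case 0
  then show ?case using assms(1) by (simp add: kernel_apply_def if_distrib[of "\<lambda>x. x * _"] cong: if_cong)
next
  case (Suc i)
  have "kernel_apply (\<lambda>l j. kernel_power V G (Suc i) j l) V v l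
      = (\<Sum>p\<in>V. G p l * kernel_apply (\<lambda>l j. kernel_power V G i j l) V v p)"
    unfolding kernel_apply_def
    by (simp add: sum_distrib_right sum_distrib_left mult_ac) (rule sum.swap)
  also have "\<dots> = ev ^ i * kernel_apply (\<lambda>l j. G j l) V v l"
    using Suc.IH by (simp add: kernel_apply_def sum_distrib_left mult_ac)
  finally show ?case by (simp only: assms(2)[OF Suc.prems] power_Suc2 mult.assoc)
qed

text \<open>
If \<open>G\<close> hardly maps anything from outside \<open>X (Suc i)\<close> into \<open>X i\<close>, then \<open>G^i\<close> hardly sees its input
outside \<open>X i\<close>.  In the step the sum over the intermediate point \<open>p\<close> is split: for \<open>p\<close> in \<open>X i\<close> the last
factor \<open>G p l\<close> is small, and for the other \<open>p\<close> the induction hypothesis applies to the power.  As \<open>G\<close> is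
a contraction, the errors only add up.
\<close>

lemma kernel_power_localised:
  assumes fin: "finite V" and G: "kernel_bound V V G 1" and XV: "\<And>i. X i \<subseteq> V" and X0: "X 0 = V"
    and small: "\<And>i. kernel_bound (X i) (V - X (Suc i)) G e" and e: "0 \<le> e"
  shows "kernel_bound V (V - X i) (kernel_power V G i) (real i * e)"
proof (induction i)
  case 0
  show ?case by (simp add: X0 kernel_bound_def kernel_apply_def norm_on_def L2_set_def)
next
  case (Suc i)
  have P: "kernel_bound V (X i) (kernel_power V G i) 1"
    by (rule kernel_bound_mono[OF kernel_power_bound[OF fin G]]) (use XV fin in auto)
  have G': "kernel_bound (V - X i) (V - X (Suc i)) G 1"
    by (rule kernel_bound_mono[OF G]) (use fin in auto)
  have "kernel_bound V (V - X (Suc i)) (\<lambda>j l. (\<Sum>p\<in>X i. kernel_power V G i j p * G p l)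
      + (\<Sum>p\<in>V - X i. kernel_power V G i j p * G p l)) (1 * e + real i * e * 1)"
    by (intro kernel_bound_add kernel_bound_comp[OF P small] kernel_bound_comp[OF Suc G']) (use e in auto)
  moreover have "kernel_power V G (Suc i) = (\<lambda>j l. (\<Sum>p\<in>X i. kernel_power V G i j p * G p l)
      + (\<Sum>p\<in>V - X i. kernel_power V G i j p * G p l))"
    using sum.subset_diff[OF XV[of i] fin] by (intro ext) (simp add: add.commute)
  ultimately show ?case by (simp only: algebra_simps of_nat_Suc mult_1_left mult_1_right)
qed

text \<open>
Both localisations come from the single hypothesis \<open>loc\<close> on \<open>G^m\<close>.  Read directly, it says that
\<open>ev^m u = G^m u\<close> depends only on \<open>u\<close> in \<open>X\<close>.  Read for the transpose, it says that eigenvectors of the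
transpose are small outside \<open>X\<close>; and \<open>v = F u\<close> is one, because \<open>D u = ev v\<close> and the transpose of
\<open>G = F* D\<close> is \<open>D F*\<close>.  Since \<open>u = F* v\<close>, the part of \<open>u\<close> in \<open>X\<close> is then controlled by the norm of \<open>F\<close>
from \<open>X\<close> to \<open>X\<close>.
\<close>

lemma eigenvalue_power_le:
  fixes N :: nat
  defines "V \<equiv> {..<N}" and "F \<equiv> fourier_kernel N"
  assumes G: "\<And>j l. G j l = (\<Sum>p\<in>V. cnj (F j p) * D p l)" and D: "\<And>j l. D j l = D l j"
    and G1: "kernel_bound V V G 1"
    and eig: "\<And>j. j \<in> V \<Longrightarrow> kernel_apply G V u j = ev * u j" and nz: "norm_on V u \<noteq> 0" and ev: "ev \<noteq> 0"
    and XV: "X \<subseteq> V" and loc: "kernel_bound V (V - X) (kernel_power V G m) e" "0 \<le> e"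
    and R: "kernel_bound X X F R" "0 \<le> R"
  shows "cmod ev ^ m \<le> R + e + e / cmod ev ^ m"
proof -
  have fin: "finite V" by (simp add: V_def)
  define F' where "F' j l = cnj (F j l)" for j l
  define v where "v = kernel_apply F V u"
  have u: "kernel_apply F' V v l = u l" if "l \<in> V" for l
    using fourier_inversion[of l N u] that by (simp add: F'_def[abs_def] v_def V_def F_def)
  have nv: "norm_on V v = norm_on V u" by (simp add: v_def V_def F_def fourier_isometry)
  have GD: "kernel_apply G V u j = kernel_apply F' V (kernel_apply D V u) j" for j
  proof -
    have "kernel_apply G V u j = (\<Sum>l\<in>V. \<Sum>p\<in>V. F' j p * D p l * u l)"
      by (simp add: kernel_apply_def G F'_def sum_distrib_right)
    also have "\<dots> = (\<Sum>p\<in>V. \<Sum>l\<in>V. F' j p * D p l * u l)" by (rule sum.swap)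
    finally show ?thesis by (simp add: kernel_apply_def sum_distrib_left mult.assoc)
  qed
  have Du: "kernel_apply D V u l = ev * v l" if "l \<in> V" for l
  proof -
    have "kernel_apply D V u l = kernel_apply F V (kernel_apply F' V (kernel_apply D V u)) l"
      using fourier_inversion_right[of l N] that by (simp add: F'_def[abs_def] V_def F_def)
    also have "\<dots> = kernel_apply F V (\<lambda>j. ev * u j) l"
      using eig by (intro kernel_apply_cong) (simp add: GD)
    also have "\<dots> = ev * v l" by (simp add: v_def kernel_apply_def sum_distrib_left mult_ac)
    finally show ?thesis .
  qed
  have veig: "kernel_apply (\<lambda>l j. G j l) V v l = ev * v l" if "l \<in> V" for l
  proof -
    have "kernel_apply (\<lambda>l j. G j l) V v l = (\<Sum>j\<in>V. \<Sum>p\<in>V. F' j p * D p l * v j)"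
      by (simp add: kernel_apply_def G F'_def sum_distrib_right)
    also have "\<dots> = (\<Sum>p\<in>V. \<Sum>j\<in>V. F' j p * D p l * v j)" by (rule sum.swap)
    also have "\<dots> = (\<Sum>p\<in>V. D l p * kernel_apply F' V v p)"
      by (simp add: kernel_apply_def sum_distrib_left D[of _ l] F'_def F_def fourier_kernel_sym mult_ac)
    also have "\<dots> = kernel_apply D V u l" using u by (simp add: kernel_apply_def)
    finally show ?thesis using Du[OF that] by simp
  qed
  have evm: "0 < cmod ev ^ m" using ev by simp
  have upper_u: "cmod ev ^ m * norm_on V u \<le> norm_on X u + e * norm_on V u"
  proof -
    have "cmod ev ^ m * norm_on V u = norm_on V (\<lambda>j. ev ^ m * u j)" by (simp add: norm_on_scale norm_power)
    also have "\<dots> = norm_on V (kernel_apply (kernel_power V G m) V u)"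
      by (intro norm_on_cong arg_cong[where f = cmod]) (simp add: kernel_power_eigen[OF fin eig])
    also have "\<dots> \<le> norm_on V (kernel_apply (kernel_power V G m) X u)
        + norm_on V (kernel_apply (kernel_power V G m) (V - X) u)"
      by (rule norm_on_split_apply[OF fin XV])
    also have "\<dots> \<le> 1 * norm_on X u + e * norm_on (V - X) u"
    proof (intro add_mono kernel_boundD)
      show "kernel_bound V X (kernel_power V G m) 1"
        by (rule kernel_bound_mono[OF kernel_power_bound[OF fin G1]]) (use fin XV in auto)
    qed (rule loc)
    also have "norm_on (V - X) u \<le> norm_on V u" using fin by (intro norm_on_mono) auto
    finally show ?thesis using loc(2) by (simp add: mult_left_mono)
  qed
  have upper_v: "cmod ev ^ m * norm_on (V - X) v \<le> e * norm_on V v"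
  proof -
    have "cmod ev ^ m * norm_on (V - X) v = norm_on (V - X) (\<lambda>j. ev ^ m * v j)" by (simp add: norm_on_scale norm_power)
    also have "\<dots> = norm_on (V - X) (kernel_apply (\<lambda>l j. kernel_power V G m j l) V v)"
      by (intro norm_on_cong arg_cong[where f = cmod]) (simp add: kernel_power_transpose_eigen[OF fin veig])
    also have "\<dots> \<le> e * norm_on V v"
      by (rule kernel_boundD[OF kernel_bound_transpose[OF loc]])
    finally show ?thesis .
  qed
  have "norm_on X u = norm_on X (kernel_apply F' V v)"
    using XV by (intro norm_on_cong) (auto simp: u)
  also have "\<dots> \<le> norm_on X (kernel_apply F' X v) + norm_on X (kernel_apply F' (V - X) v)"
    by (rule norm_on_split_apply[OF fin XV])
  also have "\<dots> \<le> R * norm_on X v + 1 * norm_on (V - X) v"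
  proof (intro add_mono kernel_boundD)
    show "kernel_bound X X F' R" unfolding F'_def by (rule kernel_bound_cnj[OF R(1)])
    have "kernel_bound V V F' 1"
      unfolding F'_def V_def F_def by (rule kernel_bound_cnj[OF fourier_bound])
    then show "kernel_bound X (V - X) F' 1" by (rule kernel_bound_mono) (use fin XV in auto)
  qed
  also have "\<dots> \<le> R * norm_on V v + e * norm_on V v / cmod ev ^ m"
    using upper_v evm R(2) fin XV
    by (intro add_mono mult_left_mono norm_on_mono) (auto simp: pos_le_divide_eq mult.commute)
  finally have "norm_on X u \<le> (R + e / cmod ev ^ m) * norm_on V u" by (simp add: nv distrib_right)
  with upper_u have "cmod ev ^ m * norm_on V u \<le> (R + e + e / cmod ev ^ m) * norm_on V u"
    by (simp add: distrib_right)
  moreover have "0 < norm_on V u" using nz norm_on_nonneg[of V u] by linarith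
  ultimately show ?thesis by simp
qed

lemma spectral_radius_eigenfunction:
  assumes B: "B \<in> carrier_mat N N" and N: "0 < N" and entries: "\<And>i j. i < N \<Longrightarrow> j < N \<Longrightarrow> B $$ (i, j) = K i j"
  obtains ev u where "cmod ev = spectral_radius B" "norm_on {..<N} u \<noteq> 0"
    "\<And>j. j < N \<Longrightarrow> kernel_apply K {..<N} u j = ev * u j"
proof -
  obtain ev where ev: "ev \<in> spectrum B" "cmod ev = spectral_radius B"
    using spectral_radius_mem_max(1)[OF B N] by auto
  then obtain w where w: "w \<in> carrier_vec N" "w \<noteq> 0\<^sub>v N" and eig: "B *\<^sub>v w = ev \<cdot>\<^sub>v w"
    using B by (auto simp: spectrum_def eigenvalue_def eigenvector_def)
  have "kernel_apply K {..<N} (\<lambda>j. w $ j) j = ev * w $ j" if j: "j < N" for j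
  proof -
    have "(B *\<^sub>v w) $ j = kernel_apply K {..<N} (\<lambda>j. w $ j) j"
      using B w j by (auto simp: kernel_apply_def scalar_prod_def entries atLeast0LessThan intro!: sum.cong)
    then show ?thesis using eig w j by simp
  qed
  moreover have "norm_on {..<N} (\<lambda>j. w $ j) \<noteq> 0"
  proof
    assume "norm_on {..<N} (\<lambda>j. w $ j) = 0"
    then have "w = 0\<^sub>v N" using w by (intro eq_vecI) (auto simp: norm_on_eq_0_iff)
    then show False using w by simp
  qed
  ultimately show thesis using ev(2) by (intro that)
qed

section \<open>Trapped points and neighbourhoods of the Cantor set\<close>

text \<open>
The starting points of orbits of the expanding map \<open>l \<mapsto> M (l mod n)\<close>, with an error below \<open>R\<close> allowed
in each step, whose first \<open>i\<close> points lie in blocks that belong to \<open>A\<close>.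
\<close>

fun trapped :: "nat \<Rightarrow> nat set \<Rightarrow> nat \<Rightarrow> real \<Rightarrow> nat \<Rightarrow> nat set" where
  "trapped M A n R 0 = {..<M * n}"
| "trapped M A n R (Suc i) = {l \<in> {..<M * n}. l div n \<in> A \<and>
    (\<exists>j \<in> trapped M A n R i. \<bar>real j - real M * real (l mod n)\<bar> < R)}"

lemma trapped_subset: "trapped M A n R i \<subseteq> {..<M * n}"
  by (cases i) auto

text \<open>
The leading \<open>i\<close> digits of such a point are in \<open>A\<close> up to the errors made.  Going back one step divides
the accumulated error by \<open>M\<close>, and \<open>(R + R) / M \<le> R\<close>, so it never exceeds \<open>R\<close>.
\<close>

lemma trapped_near_cantor:
  assumes M: "2 \<le> M" and R: "0 \<le> R" and i: "i \<le> Suc k" and l: "l \<in> trapped M A (M ^ k) R i"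
  shows "\<exists>c \<in> cantor_set M A i. \<bar>real l - real c * real M ^ (Suc k - i)\<bar> \<le> real M ^ (Suc k - i) + R"
  using i l
proof (induction i arbitrary: l)
  case 0
  then have "real l < real (M ^ Suc k)" by (simp only: of_nat_less_iff) simp
  then show ?case using R by (simp add: cantor_set_0)
next
  case (Suc i)
  define n a b where "n = M ^ k" and "a = l div n" and "b = l mod n"
  obtain j where a: "a \<in> A" and j: "j \<in> trapped M A n R i" and near: "\<bar>real j - real M * real b\<bar> < R"
    using Suc.prems(2) by (auto simp: n_def a_def b_def)
  obtain c where c: "c \<in> cantor_set M A i" "\<bar>real j - real c * real M ^ (Suc k - i)\<bar> \<le> real M ^ (Suc k - i) + R"
    using Suc.IH[of j] Suc.prems(1) j by (auto simp: n_def)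
  have "c + M ^ i * a \<in> cantor_set M A (i + 1)"
    unfolding cantor_set_add cantor_set_1 using c(1) a by force
  moreover have "\<bar>real l - real (c + M ^ i * a) * real M ^ (Suc k - Suc i)\<bar> \<le> real M ^ (Suc k - Suc i) + R"
  proof -
    define x where "x = real M ^ (k - i)"
    have x1: "real M ^ (Suc k - i) = real M * x" using Suc.prems(1) by (simp add: x_def Suc_diff_le)
    have x2: "real n = real M ^ i * x" using Suc.prems(1) by (simp add: n_def x_def power_add[symmetric])
    have l: "real l = real n * real a + real b"
      unfolding a_def b_def by (metis mult_div_mod_eq of_nat_add of_nat_mult)
    have eq: "real l - real (c + M ^ i * a) * x = real b - real c * x"
      unfolding l x2 by (simp add: algebra_simps)
    have "real M * real b - real c * (real M * x) = real M * (real b - real c * x)"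
      by (simp add: algebra_simps)
    then have "real M * \<bar>real b - real c * x\<bar> = \<bar>real M * real b - real c * (real M * x)\<bar>"
      by (simp only: abs_mult abs_of_nat)
    also have "\<dots> \<le> 2 * R + real M * x" using near c(2) unfolding x1 by linarith
    also have "\<dots> \<le> real M * R + real M * x" using M R by (intro add_right_mono mult_right_mono) auto
    finally have "real M * \<bar>real b - real c * x\<bar> \<le> real M * (x + R)" by (simp add: algebra_simps)
    then have "\<bar>real b - real c * x\<bar> \<le> x + R" using M by simp
    then show ?thesis using eq by (simp add: x_def)
  qed
  ultimately show ?case by (intro bexI[of _ "c + M ^ i * a"]) simp_all
qed

text \<open>
After \<open>k + 1 - t\<close> steps the lowest \<open>t\<close> digits are free; filling them with digits from \<open>A\<close> moves the
nearby multiple of \<open>M^t\<close> by less than \<open>M^t\<close>.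
\<close>

lemma trapped_in_neighbourhood:
  assumes A: "A \<subseteq> {0..<M}" "A \<noteq> {}" and M: "2 \<le> M" and t: "t \<le> Suc k"
    and l: "l \<in> trapped M A (M ^ k) (real (M ^ t)) (Suc k - t)"
  shows "\<exists>c \<in> cantor_set M A (Suc k). \<bar>int l - int c\<bar> \<le> int (3 * M ^ t)"
proof -
  have eq: "Suc k - (Suc k - t) = t" using t by simp
  obtain c where c: "c \<in> cantor_set M A (Suc k - t)"
    and near: "\<bar>real l - real c * real M ^ t\<bar> \<le> real M ^ t + real (M ^ t)"
    using trapped_near_cantor[OF M _ _ l] unfolding eq by auto
  have "card (cantor_set M A t) \<noteq> 0"
    using A finite_subset[OF A(1)] by (simp add: card_cantor_set card_eq_0_iff)
  then obtain d where d: "d \<in> cantor_set M A t" by fastforce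
  have "d + M ^ t * c \<in> cantor_set M A (t + (Suc k - t))"
    unfolding cantor_set_add using c d by force
  then have mem: "d + M ^ t * c \<in> cantor_set M A (Suc k)" using t by simp
  have "real d < real (M ^ t)" using cantor_set_less[OF A(1) d] by (simp only: of_nat_less_iff)
  moreover have "real (d + M ^ t * c) = real d + real c * real M ^ t" by simp
  ultimately have "\<bar>real l - real (d + M ^ t * c)\<bar> \<le> 3 * real (M ^ t)"
    using near by (simp only: of_nat_power)
  then have "real_of_int \<bar>int l - int (d + M ^ t * c)\<bar> \<le> real_of_int (int (3 * M ^ t))"
    by (simp only: of_int_abs of_int_diff of_int_of_nat_eq of_nat_mult of_nat_numeral)
  then have "\<bar>int l - int (d + M ^ t * c)\<bar> \<le> int (3 * M ^ t)" by (simp only: of_int_le_iff)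
  then show ?thesis using mem by blast
qed

text \<open>
Translating the output of a Fourier transform modulates its input, which does not change norms.
The shift is by an integer, and points that leave the natural numbers are dropped, so that no
reduction modulo \<open>N\<close> is needed.
\<close>

lemma fourier_bound_shift:
  assumes K: "kernel_bound C L (fourier_kernel N) r" "0 \<le> r" and fin: "finite C" "finite L"
  shows "kernel_bound {j. int j - s \<in> int ` C} L (fourier_kernel N) r"
    and "finite {j. int j - s \<in> int ` C}"
proof -
  define S where "S = {j. int j - s \<in> int ` C}"
  define f where "f j = nat (int j - s)" for j
  have f: "int (f j) = int j - s" "f j \<in> C" if "j \<in> S" for j using that by (auto simp: S_def f_def)
  have inj: "inj_on f S"
  proof (rule inj_onI)
    fix x y assume "x \<in> S" "y \<in> S" "f x = f y"
    then have "int x - s = int y - s" using f(1) by metis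
    then show "x = y" by simp
  qed
  have sub: "f ` S \<subseteq> C" using f by auto
  have finS: "finite S" using inj sub fin(1) by (metis finite_imageD finite_subset)
  then show "finite {j. int j - s \<in> int ` C}" by (simp add: S_def)
  have "kernel_bound (f ` S) L (fourier_kernel N) r"
    by (rule kernel_bound_mono[OF K(1) sub]) (use fin K(2) in auto)
  then have "kernel_bound S L (\<lambda>j l. fourier_kernel N (f j) l) r"
    using kernel_bound_reindex[OF inj inj_on_id, of L "fourier_kernel N" r] by simp
  then have "kernel_bound S L (\<lambda>j l. 1 * fourier_kernel N (f j) l * cis (- 2 * pi * of_int s * real l / real N)) r"
    by (rule kernel_bound_weights) (use K(2) finS fin in auto)
  moreover have "1 * fourier_kernel N (f j) l * cis (- 2 * pi * of_int s * real l / real N) = fourier_kernel N j l"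
    if "j \<in> S" for j l
  proof -
    have "real_of_int (int (f j)) = real_of_int (int j - s)" using f(1)[OF that] by simp
    then have rj: "real j = real (f j) + of_int s" by simp
    have "cis (- 2 * pi * real (f j) * real l / real N) * cis (- 2 * pi * of_int s * real l / real N)
        = cis (- 2 * pi * real j * real l / real N)"
      unfolding cis_mult by (intro arg_cong[where f = cis]) (simp add: rj algebra_simps add_divide_distrib diff_divide_distrib)
    then show ?thesis by (simp add: fourier_kernel_def)
  qed
  ultimately have "kernel_bound S L (fourier_kernel N) r"
    by (subst (asm) kernel_bound_cong) auto
  then show "kernel_bound {j. int j - s \<in> int ` C} L (fourier_kernel N) r" by (simp add: S_def)
qed

lemma fourier_bound_neighbourhood_rows:
  assumes K: "kernel_bound C L (fourier_kernel N) r" "0 \<le> r" and fin: "finite C" "finite L"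
    and X: "\<And>x. x \<in> X \<Longrightarrow> \<exists>c\<in>C. \<bar>int x - int c\<bar> \<le> int b"
  shows "kernel_bound X L (fourier_kernel N) (real (2 * b + 1) * r)" and "finite X"
proof -
  define S where "S s = {j. int j - s \<in> int ` C}" for s
  define U where "U = (\<Union>s\<in>{- int b..int b}. S s)"
  have finS: "finite (S s)" and KS: "kernel_bound (S s) L (fourier_kernel N) r" for s
    unfolding S_def using fourier_bound_shift[OF K fin] by auto
  have XU: "X \<subseteq> U"
  proof
    fix x assume "x \<in> X"
    then obtain c where c: "c \<in> C" "\<bar>int x - int c\<bar> \<le> int b" using X by blast
    then have "x \<in> S (int x - int c)" "int x - int c \<in> {- int b..int b}" by (auto simp: S_def)
    then show "x \<in> U" unfolding U_def by blast
  qed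
  have finU: "finite U" using finS by (simp add: U_def)
  then show "finite X" using XU by (rule rev_finite_subset)
  have card: "card {- int b..int b} = 2 * b + 1" by simp
  have "kernel_bound U L (fourier_kernel N) (real (2 * b + 1) * r)"
    using kernel_bound_UN_rows[where I = "{- int b..int b}" and J = S and L = L and K = "fourier_kernel N" and r = r] finS KS K(2)
    unfolding U_def card by simp
  then show "kernel_bound X L (fourier_kernel N) (real (2 * b + 1) * r)"
    by (rule kernel_bound_mono) (use XU finU fin K(2) in auto)
qed

text \<open>
The bound on rows applied twice, once for the outputs and, through the transpose of the symmetric
kernel, once for the inputs.
\<close>

lemma fourier_bound_neighbourhood:
  assumes K: "kernel_bound C C (fourier_kernel N) r" "0 \<le> r" and fin: "finite C"
    and X: "\<And>x. x \<in> X \<Longrightarrow> \<exists>c\<in>C. \<bar>int x - int c\<bar> \<le> int b"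
  shows "kernel_bound X X (fourier_kernel N) (real (2 * b + 1) ^ 2 * r)"
proof -
  have rows: "kernel_bound X C (fourier_kernel N) (real (2 * b + 1) * r)" and finX: "finite X"
    using fourier_bound_neighbourhood_rows[OF K fin fin X] by auto
  have sym: "(\<lambda>l j. fourier_kernel N j l) = fourier_kernel N"
    by (intro ext) (rule fourier_kernel_sym)
  have "kernel_bound C X (fourier_kernel N) (real (2 * b + 1) * r)"
    using kernel_bound_transpose[OF rows] K(2) unfolding sym by simp
  from fourier_bound_neighbourhood_rows(1)[OF this _ fin finX X] K(2)
  show ?thesis by (simp add: power2_eq_square mult.assoc)
qed

section \<open>The spectral radius\<close>

text \<open>
Everything up to the choice of parameters.  The uncertainty principle for the neighbourhood of width
\<open>3 M^t\<close> loses a power of \<open>M^t\<close>, while the localisation errors gain \<open>(M^t)^(-q)\<close> for any prescribed \<open>q\<close>.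
\<close>

lemma spectral_radius_power_le:
  assumes A: "A \<subseteq> {0..<M}" "A \<noteq> {}" and M: "2 \<le> M" and \<chi>: "cutoff \<chi>"
  shows "\<exists>C\<ge>0. \<forall>k t. t \<le> Suc k \<longrightarrow> 0 < spectral_radius (baker_map M A \<chi> (M ^ Suc k)) \<longrightarrow>
    spectral_radius (baker_map M A \<chi> (M ^ Suc k)) ^ (Suc k - t)
      \<le> real (6 * M ^ t + 1) ^ 2 * cantor_norm M A (Suc k)
        + real (Suc k) * (real M ^ Suc k * (C / (real M ^ t) ^ q))
        + real (Suc k) * (real M ^ Suc k * (C / (real M ^ t) ^ q))
            / spectral_radius (baker_map M A \<chi> (M ^ Suc k)) ^ (Suc k - t)"
proof -
  have M0: "0 < M" using M by simp
  obtain C where C: "0 \<le> C" and decay: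
    "\<And>n j l d. \<lbrakk>0 < n; j < M * n; l < M * n; l div n \<in> A; 0 < d; d \<le> \<bar>real j - real M * real (l mod n)\<bar>\<rbrakk>
      \<Longrightarrow> cmod (baker_kernel M A \<chi> n j l) \<le> C / d ^ q"
    using baker_kernel_decay[OF \<chi> M0] by metis
  have "spectral_radius (baker_map M A \<chi> (M ^ Suc k)) ^ (Suc k - t)
      \<le> real (6 * M ^ t + 1) ^ 2 * cantor_norm M A (Suc k)
        + real (Suc k) * (real M ^ Suc k * (C / (real M ^ t) ^ q))
        + real (Suc k) * (real M ^ Suc k * (C / (real M ^ t) ^ q))
            / spectral_radius (baker_map M A \<chi> (M ^ Suc k)) ^ (Suc k - t)"
    if t: "t \<le> Suc k" and pos: "0 < spectral_radius (baker_map M A \<chi> (M ^ Suc k))" for k t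
  proof -
    define n where "n = M ^ k"
    have n: "0 < n" and N: "M ^ Suc k = M * n" using M0 by (auto simp: n_def)
    define V where "V = {..<M * n}"
    define G where "G = baker_kernel M A \<chi> n"
    define R where "R = real (M ^ t)"
    define X where "X = trapped M A n R"
    define e where "e = real (M * n) * (C / R ^ q)"
    define m where "m = Suc k - t"
    have R: "0 < R" using M0 by (simp add: R_def)
    have e: "0 \<le> e" using C R by (simp add: e_def)
    have fin: "finite V" by (simp add: V_def)
    have XV: "X i \<subseteq> V" for i unfolding X_def V_def by (rule trapped_subset)
    have finA: "finite A" using A(1) finite_subset by auto
    have G1: "kernel_bound V V G 1" unfolding V_def G_def by (rule baker_kernel_bound[OF \<chi> n])
    have small: "kernel_bound (X i) (V - X (Suc i)) G e" for i
    proof -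
      have entry: "cmod (G j l) \<le> C / R ^ q" if j: "j \<in> X i" and l: "l \<in> V - X (Suc i)" for j l
      proof (cases "l div n \<in> A")
        case True
        have "\<not> \<bar>real j - real M * real (l mod n)\<bar> < R"
          using l True j by (auto simp: X_def V_def)
        then show ?thesis
          unfolding G_def using True l j XV[of i] n R by (intro decay) (auto simp: V_def)
      next
        case False
        then have "G j l = 0" by (auto simp: G_def baker_kernel_def block_kernel_def intro!: sum.neutral)
        then show ?thesis using C R by simp
      qed
      have finX: "finite (X i)" using XV fin finite_subset by blast
      have "kernel_bound (X i) (V - X (Suc i)) G (sqrt (card (X i) * card (V - X (Suc i))) * (C / R ^ q))"
        by (rule kernel_bound_entries[OF finX _ _ entry]) (use fin C R in auto)
      moreover have "sqrt (card (X i) * card (V - X (Suc i))) * (C / R ^ q) \<le> e"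
      proof -
        have "card (X i) \<le> M * n" "card (V - X (Suc i)) \<le> M * n"
          using card_mono[OF fin XV[of i]] card_mono[OF fin, of "V - X (Suc i)"] by (auto simp: V_def)
        then have "card (X i) * card (V - X (Suc i)) \<le> (M * n) * (M * n)" by (rule mult_mono) auto
        then have "real (card (X i) * card (V - X (Suc i))) \<le> real (M * n) * real (M * n)"
          by (metis of_nat_le_iff of_nat_mult)
        then have "sqrt (card (X i) * card (V - X (Suc i))) \<le> sqrt (real (M * n) * real (M * n))"
          by (rule real_sqrt_le_mono)
        then have "sqrt (card (X i) * card (V - X (Suc i))) \<le> real (M * n)"
          by (simp only: power2_eq_square[symmetric] real_sqrt_abs abs_of_nat)
        then show ?thesis unfolding e_def using C R by (intro mult_right_mono) auto
      qed
      ultimately show ?thesis using finX fin e by (elim kernel_bound_mono) auto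
    qed
    have loc: "kernel_bound V (V - X m) (kernel_power V G m) (real m * e)"
      by (rule kernel_power_localised[where X = X, OF fin G1 XV _ small e]) (simp add: X_def V_def)
    have near: "\<exists>c\<in>cantor_set M A (Suc k). \<bar>int x - int c\<bar> \<le> int (3 * M ^ t)" if "x \<in> X m" for x
      using that trapped_in_neighbourhood[OF A M t] by (simp add: X_def n_def R_def m_def)
    have cn0: "0 \<le> cantor_norm M A (Suc k)" by (rule cantor_norm_nonneg[OF A(1)])
    have fup: "kernel_bound (X m) (X m) (fourier_kernel (M * n)) (real (2 * (3 * M ^ t) + 1) ^ 2 * cantor_norm M A (Suc k))"
      using fourier_bound_neighbourhood[OF cantor_norm_bound[OF A(1), of "Suc k"] cn0 finite_cantor_set[OF A(1)] near]
      unfolding N .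
    obtain ev u where ev: "cmod ev = spectral_radius (baker_map M A \<chi> (M * n))"
      and nz: "norm_on {..<M * n} u \<noteq> 0" and eig: "\<And>j. j < M * n \<Longrightarrow> kernel_apply G {..<M * n} u j = ev * u j"
      using spectral_radius_eigenfunction[OF baker_map_carrier[OF finA], of "M * n" M \<chi> G] n M0
        baker_map_index[OF A(1) n, of _ _ \<chi>] unfolding G_def by (metis mult_pos_pos)
    have "cmod ev ^ m \<le> real (2 * (3 * M ^ t) + 1) ^ 2 * cantor_norm M A (Suc k) + real m * e + real m * e / cmod ev ^ m"
    proof (rule eigenvalue_power_le)
      show "G j l = (\<Sum>p\<in>{..<M * n}. cnj (fourier_kernel (M * n) j p) * block_kernel A \<chi> n p l)" for j l
        by (simp add: G_def baker_kernel_def)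
      show "block_kernel A \<chi> n j l = block_kernel A \<chi> n l j" for j l by (rule block_kernel_sym)
      show "ev \<noteq> 0" using pos ev N by auto
    qed (use G1 eig nz XV loc e fup cn0 in \<open>auto simp: V_def\<close>)
    moreover have "real m * e \<le> real (Suc k) * e" using e by (intro mult_right_mono) (auto simp: m_def)
    moreover from this have "real m * e / cmod ev ^ m \<le> real (Suc k) * e / cmod ev ^ m"
      by (rule divide_right_mono) simp
    ultimately have "cmod ev ^ m \<le> real (6 * M ^ t + 1) ^ 2 * cantor_norm M A (Suc k)
        + real (Suc k) * e + real (Suc k) * e / cmod ev ^ m"
      by simp
    moreover have "e = real M ^ Suc k * (C / (real M ^ t) ^ q)" by (simp add: e_def R_def n_def)
    ultimately show ?thesis unfolding ev m_def N by simp
  qed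
  then show ?thesis using C by blast
qed

text \<open>
Suppose the spectral radius \<open>\<rho>\<close> exceeds \<open>M^(-\<alpha>)\<close>, and take \<open>t = k div P\<close>.  Then the left-hand side of
\<open>spectral_radius_power_le\<close> is at least \<open>M^(-\<alpha> k)\<close>.  Relative to this, the main term is of order
\<open>M^((\<alpha> - b + 2/P) k)\<close> for any \<open>b < \<beta>\<close>, and the errors are of order \<open>k M^((1 + 2 \<alpha> - q/P) k)\<close>, where
one of the two \<open>\<alpha>\<close> comes from dividing by \<open>\<rho>^(k-t)\<close>.  Both tend to zero when \<open>P\<close> is large and then
\<open>q\<close> is large compared with \<open>P\<close>.
\<close>

lemma spectral_radius_eventually_le:
  assumes A: "A \<subseteq> {0..<M}" "A \<noteq> {}" and M: "2 \<le> M" and \<chi>: "cutoff \<chi>"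
    and lim: "(\<lambda>k. - (ln (cantor_norm M A k) / (real k * ln (real M)))) \<longlonglongrightarrow> \<beta>"
    and \<alpha>: "0 < \<alpha>" "\<alpha> < \<beta>"
  shows "\<forall>\<^sub>F k in sequentially. spectral_radius (baker_map M A \<chi> (M ^ k)) \<le> real M powr (- \<alpha>)"
proof -
  define b where "b = (\<alpha> + \<beta>) / 2"
  have b: "\<alpha> < b" "b < \<beta>" using \<alpha> by (auto simp: b_def)
  obtain P :: nat where P: "2 / (b - \<alpha>) < real P" using reals_Archimedean2 by blast
  have P0: "0 < real P" by (rule less_trans[OF _ P]) (use b in simp)
  \<comment> \<open>The common exponential rate; \<open>P\<close> makes it positive and \<open>q\<close> lets the errors reach it.\<close>
  define \<gamma> where "\<gamma> = b - \<alpha> - 2 / real P"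
  have \<gamma>: "0 < \<gamma>" using P P0 b by (simp add: \<gamma>_def field_simps)
  obtain q :: nat where q: "real P * (1 + 2 * \<alpha> + \<gamma>) < real q" using reals_Archimedean2 by blast
  have qP: "1 + 2 * \<alpha> + \<gamma> \<le> real q / real P"
    using q P0 by (simp add: field_simps)
  obtain C where C: "0 \<le> C" and main:
    "\<And>k t. \<lbrakk>t \<le> Suc k; 0 < spectral_radius (baker_map M A \<chi> (M ^ Suc k))\<rbrakk> \<Longrightarrow>
      spectral_radius (baker_map M A \<chi> (M ^ Suc k)) ^ (Suc k - t)
      \<le> real (6 * M ^ t + 1) ^ 2 * cantor_norm M A (Suc k)
        + real (Suc k) * (real M ^ Suc k * (C / (real M ^ t) ^ q))
        + real (Suc k) * (real M ^ Suc k * (C / (real M ^ t) ^ q))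
            / spectral_radius (baker_map M A \<chi> (M ^ Suc k)) ^ (Suc k - t)"
    using spectral_radius_power_le[OF A M \<chi>, of q] by blast
  define m where "m = real M"
  have m: "1 < m" using M by (simp add: m_def)
  have powr_le: "m powr x \<le> m powr y" if "x \<le> y" for x y using that m by simp
  define x where "x = m powr (- \<gamma>)"
  have x: "0 < x" "x < 1" using m \<gamma> by (auto simp: x_def powr_less_one)
  have xk: "x ^ k = m powr (- (\<gamma> * real k))" for k
    using x(1) by (simp add: x_def powr_powr flip: powr_realpow)
  have "(\<lambda>k. 49 * x ^ k + 2 * C * m ^ q * (real k * x ^ k)) \<longlonglongrightarrow> 49 * 0 + 2 * C * m ^ q * 0"
    using x by (intro tendsto_intros LIMSEQ_power_zero powser_times_n_limit_0) auto
  then have "\<forall>\<^sub>F k in sequentially. 49 * x ^ k + 2 * C * m ^ q * (real k * x ^ k) < 1"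
    by (rule order_tendstoD) simp
  then show ?thesis
    using cantor_norm_eventually_le[OF A M lim b(2)] eventually_gt_at_top[of 0]
  proof eventually_elim
    case (elim k)
    define \<rho> where "\<rho> = spectral_radius (baker_map M A \<chi> (M ^ k))"
    show ?case unfolding \<rho>_def[symmetric] m_def[symmetric]
    proof (rule ccontr)
      assume "\<not> \<rho> \<le> m powr - \<alpha>"
      then have \<rho>: "m powr - \<alpha> < \<rho>" by simp
      have \<rho>0: "0 < \<rho>" by (rule le_less_trans[OF _ \<rho>]) simp
      define t where "t = k div P"
      have t: "t \<le> k" by (simp add: t_def)
      have tP: "real t \<le> real k / real P" "real k / real P - 1 \<le> real t"
      proof -
        have "k = t * P + k mod P" "k mod P < P" using P0 by (auto simp: t_def)
        then have "real k = real t * real P + real (k mod P)" "real (k mod P) < real P"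
          by (metis of_nat_add of_nat_mult, simp)
        then show "real t \<le> real k / real P" "real k / real P - 1 \<le> real t"
          using P0 by (auto simp: field_simps)
      qed
      define E where "E = real k * (m ^ k * (C / (m ^ t) ^ q))"
      have E0: "0 \<le> E" using C m by (simp add: E_def)
      have ineq: "\<rho> ^ (k - t) \<le> real (6 * M ^ t + 1) ^ 2 * cantor_norm M A k + E + E / \<rho> ^ (k - t)"
        using main[of t "k - 1"] t elim(3) \<rho>0 unfolding \<rho>_def E_def m_def by simp
      have low: "m powr (- (\<alpha> * real k)) \<le> \<rho> ^ (k - t)"
      proof -
        have "m powr (- (\<alpha> * real k)) \<le> m powr (- (\<alpha> * real (k - t)))"
          using \<alpha> by (intro powr_le) (simp add: mult_left_mono)
        also have "\<dots> = (m powr - \<alpha>) ^ (k - t)"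
          using m by (simp add: powr_powr flip: powr_realpow)
        also have "\<dots> \<le> \<rho> ^ (k - t)" using \<rho> by (intro power_mono) auto
        finally show ?thesis .
      qed
      have "E / \<rho> ^ (k - t) \<le> E / m powr (- (\<alpha> * real k))"
        using low E0 m \<rho>0 by (intro divide_left_mono mult_pos_pos) auto
      also have "\<dots> = E * m powr (\<alpha> * real k)" by (simp add: powr_minus divide_inverse)
      finally have E1: "E / \<rho> ^ (k - t) \<le> E * m powr (\<alpha> * real k)" .
      have E2: "E \<le> E * m powr (\<alpha> * real k)"
        using E0 m \<alpha> by (simp add: mult_le_cancel_left1 ge_one_powr_ge_zero)
      have E3: "E \<le> real k * (C * m ^ q * m powr (real k - real q / real P * real k))"
      proof -
        have mt: "(m ^ t) ^ q = m powr (real t * real q)"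
          using m by (simp add: powr_realpow[symmetric] powr_powr)
        have "m powr ((real k / real P - 1) * real q) \<le> (m ^ t) ^ q"
          unfolding mt using tP by (intro powr_le mult_right_mono) auto
        then have "C / (m ^ t) ^ q \<le> C / m powr ((real k / real P - 1) * real q)"
          using C m by (intro divide_left_mono) auto
        also have "\<dots> = C * m powr (real q - real q / real P * real k)"
          by (simp add: divide_inverse powr_minus[symmetric] algebra_simps)
        finally have "E \<le> real k * (m ^ k * (C * m powr (real q - real q / real P * real k)))"
          unfolding E_def using m by (intro mult_left_mono) auto
        also have "m ^ k * (C * m powr (real q - real q / real P * real k))
            = C * (m powr real k * m powr (real q - real q / real P * real k))"
          using m by (simp add: powr_realpow)
        also have "m powr real k * m powr (real q - real q / real P * real k)
            = m ^ q * m powr (real k - real q / real P * real k)"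
          using m by (simp add: powr_realpow[symmetric] algebra_simps flip: powr_add)
        finally show ?thesis by (simp add: mult_ac)
      qed
      have H: "real (6 * M ^ t + 1) ^ 2 * cantor_norm M A k
          \<le> 49 * m powr (2 / real P * real k) * m powr (- (b * real k))"
      proof (rule mult_mono)
        have "real (6 * M ^ t + 1) \<le> 7 * m ^ t" using m by (simp add: m_def)
        then have "real (6 * M ^ t + 1) ^ 2 \<le> (7 * m ^ t) ^ 2" by (rule power_mono) simp
        also have "\<dots> = 49 * m powr (2 * real t)"
          using m by (simp add: power_mult_distrib powr_realpow[symmetric] powr_powr mult.commute flip: powr_realpow)
        also have "\<dots> \<le> 49 * m powr (2 / real P * real k)"
          using tP by (intro mult_left_mono powr_le) auto
        finally show "real (6 * M ^ t + 1) ^ 2 \<le> 49 * m powr (2 / real P * real k)" .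
        show "cantor_norm M A k \<le> m powr (- (b * real k))" using elim(2) by (simp add: m_def)
      qed (use cantor_norm_nonneg[OF A(1)] in auto)
      have "m powr (- (\<alpha> * real k)) \<le> 49 * m powr (2 / real P * real k) * m powr (- (b * real k))
          + 2 * (E * m powr (\<alpha> * real k))"
        using low ineq H E1 E2 by linarith
      also have "\<dots> \<le> 49 * m powr (2 / real P * real k) * m powr (- (b * real k))
          + 2 * (real k * (C * m ^ q * m powr (real k - real q / real P * real k)) * m powr (\<alpha> * real k))"
        using E3 by (intro add_left_mono mult_left_mono mult_right_mono) auto
      finally have "m powr (\<alpha> * real k) * m powr (- (\<alpha> * real k))
          \<le> m powr (\<alpha> * real k) * (49 * m powr (2 / real P * real k) * m powr (- (b * real k))
          + 2 * (real k * (C * m ^ q * m powr (real k - real q / real P * real k)) * m powr (\<alpha> * real k)))"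
        by (intro mult_left_mono) auto
      also have "m powr (\<alpha> * real k) * m powr (- (\<alpha> * real k)) = 1"
        using m by (simp flip: powr_add)
      also have "m powr (\<alpha> * real k) * (49 * m powr (2 / real P * real k) * m powr (- (b * real k))
          + 2 * (real k * (C * m ^ q * m powr (real k - real q / real P * real k)) * m powr (\<alpha> * real k)))
        = 49 * (m powr (\<alpha> * real k) * m powr (2 / real P * real k) * m powr (- (b * real k)))
          + 2 * C * m ^ q * (real k * (m powr (\<alpha> * real k) * m powr (real k - real q / real P * real k) * m powr (\<alpha> * real k)))"
        by (simp add: algebra_simps)
      also have "\<dots> = 49 * m powr ((\<alpha> + 2 / real P - b) * real k)
          + 2 * C * m ^ q * (real k * m powr ((1 + 2 * \<alpha> - real q / real P) * real k))"
        by (simp add: algebra_simps flip: powr_add)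
      also have "\<dots> \<le> 49 * x ^ k + 2 * C * m ^ q * (real k * x ^ k)"
      proof -
        have "(\<alpha> + 2 / real P - b) * real k \<le> (- \<gamma>) * real k"
          by (intro mult_right_mono) (auto simp: \<gamma>_def)
        moreover have "(1 + 2 * \<alpha> - real q / real P) * real k \<le> (- \<gamma>) * real k"
          using qP by (intro mult_right_mono) auto
        ultimately show ?thesis
          unfolding xk using C m by (intro add_mono mult_left_mono powr_le) auto
      qed
      also have "\<dots> < 1" by (rule elim(1))
      finally show False by simp
    qed
  qed
qed

theorem theorem2:
  fixes M :: nat and A :: "nat set"
  assumes "A \<subseteq> {0..<M}" and "1 < card A" and "card A < M"
  shows "\<exists>\<beta>::real.
    (\<lambda>k. - (ln (cantor_norm M A k) / (real k * ln (real M)))) \<longlonglongrightarrow> \<beta> \<and>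
    \<beta> > max 0 (1 / 2 - cantor_dim M A) \<and>
    (\<forall>\<chi>::real \<Rightarrow> real. cutoff \<chi> \<longrightarrow>
       limsup (\<lambda>k. ereal (spectral_radius (baker_map M A \<chi> (M ^ k)))) \<le> ereal (real M powr - \<beta>))"
proof -
  obtain \<beta> where lim: "(\<lambda>k. - (ln (cantor_norm M A k) / (real k * ln (real M)))) \<longlonglongrightarrow> \<beta>"
    and gt: "\<beta> > max 0 (1 / 2 - cantor_dim M A)"
    using cantor_exponent[OF assms] by blast
  have A: "A \<noteq> {}" and M: "2 \<le> M" using assms by auto
  have "limsup (\<lambda>k. ereal (spectral_radius (baker_map M A \<chi> (M ^ k)))) \<le> ereal (real M powr - \<beta>)"
    if \<chi>: "cutoff \<chi>" for \<chi>
    unfolding Limsup_le_iff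
  proof (intro allI impI)
    fix y assume y: "ereal (real M powr - \<beta>) < y"
    show "\<forall>\<^sub>F k in sequentially. ereal (spectral_radius (baker_map M A \<chi> (M ^ k))) < y"
    proof (cases y)
      case (real r)
      have "((\<lambda>a. real M powr - a) \<longlongrightarrow> real M powr - \<beta>) (at_left \<beta>)"
        using M by (intro tendsto_intros) auto
      then have "\<forall>\<^sub>F a in at_left \<beta>. real M powr - a < r"
        by (rule order_tendstoD) (use y real in simp)
      moreover have "\<forall>\<^sub>F a in at_left \<beta>. a \<in> {0<..<\<beta>}"
        by (rule eventually_at_left_real) (use gt in simp)
      ultimately have "\<forall>\<^sub>F a in at_left \<beta>. real M powr - a < r \<and> a \<in> {0<..<\<beta>}"
        by (rule eventually_conj)
      then obtain a where a: "real M powr - a < r" "0 < a" "a < \<beta>"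
        using eventually_happens' trivial_limit_at_left_real by fastforce
      show ?thesis
        using spectral_radius_eventually_le[OF assms(1) A M \<chi> lim a(2,3)]
        by eventually_elim (use a(1) real in simp)
    qed (use y in auto)
  qed
  then show ?thesis using lim gt by blast
qed

end
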